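(* Every connected, nonhamiltonian, locally linear graph with at least $3$ vertices has at least $12$ vertices, and there exists a connected, nonhamiltonian, locally linear graph with exactly $12$ vertices. That is, the minimum order of a nonhamiltonian locally linear graph is $12$.
   Context: All graphs are finite, simple and connected. For a vertex $v$ of a graph $G$, $N(v)$ is the set of neighbours of $v$ and $G[S]$ is the subgraph induced by a vertex set $S$. A graph $G$ is locally linear if for every vertex $v$ of $G$ the induced subgraph $G[N(v)]$ is a path. A graph is hamiltonian if it contains a cycle through all of its vertices. *)

theory Defs
  imports "Graph_Theory.Graph_Theory"
begin

definition neighbourhood :: "('a, 'b) pre_digraph \<Rightarrow> 'a \<Rightarrow> 'a set" where
  "neighbourhood G v = {u. v \<rightarrow>\<^bsub>G\<^esub> u}"

(* The path x_0 - x_1 - ... - x_k with k >= 0, as a symmetric digraph; a single vertex is a path. *)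
definition path_graph :: "('a, 'b) pre_digraph \<Rightarrow> bool" where
  "path_graph H \<longleftrightarrow> (\<exists>xs. xs \<noteq> [] \<and> distinct xs \<and> verts H = set xs \<and>
     arcs_ends H = {(xs ! i, xs ! j) | i j.
       i < length xs \<and> j < length xs \<and> (j = Suc i \<or> i = Suc j)})"

definition locally_linear :: "('a, 'b) pre_digraph \<Rightarrow> bool" where
  "locally_linear G \<longleftrightarrow> (\<forall>v \<in> verts G. path_graph (G \<restriction> neighbourhood G v))"

(* The length bound is needed because traversing one edge back and forth is a cycle in the
   sense of pre_digraph.cycle. *)
definition hamiltonian :: "('a, 'b) pre_digraph \<Rightarrow> bool" where
  "hamiltonian G \<longleftrightarrow>
     (\<exists>p. pre_digraph.cycle G p \<and> 3 \<le> length p \<and> tail G ` set p = verts G)"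

end

theory Submission
  imports Defs
begin

text \<open>
  A locally linear graph triangulates a surface with every vertex on the boundary: the edges
  lying in exactly one triangle form disjoint cycles covering all vertices, and away from a lone
  triangle each of them has length at least 4. One such cycle is hamiltonian and three need 12
  vertices. With two boundary cycles \<open>A\<close> and \<open>B\<close>, boundary edges \<open>x x'\<close> of \<open>A\<close> and \<open>y y'\<close> of
  \<open>B\<close> joined by edges \<open>x y\<close> and \<open>x' y'\<close> (a ladder) let us splice the two cycles into a
  hamiltonian one. If there is no ladder and \<open>A\<close> has no chord, the apex in \<open>B\<close> of every edge of
  \<open>A\<close> carries two nonadjacent chords of \<open>B\<close> (a wedge), and going around \<open>A\<close> these apexes cannot
  all coincide; this forces \<open>B\<close> to have at least 8 vertices. A 4-cycle \<open>A\<close> has no chord, and a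
  5-cycle at most one, which then cuts off a vertex of degree 2; the same analysis then gives
  \<open>B\<close> at least 7 vertices.

  The extremal graph is an annulus triangulated between a 4-cycle and a ring of 4 vertices, with
  a vertex of degree 2 glued to every ring edge. A hamiltonian cycle would have to enter every
  ring vertex from a degree 2 vertex and so could never leave the inner 4-cycle.
\<close>

section \<open>Links and boundary edges\<close>

text \<open>A one-vertex link occurs only in a single edge, hence the bound 2 in
  \<open>link_exists\<close>. \<open>edge_out\<close> is connectedness expressed through
  cuts.\<close>

locale locally_linear_graph =
  fixes V :: "'a set" and E :: "'a \<Rightarrow> 'a \<Rightarrow> bool"
  assumes finite_V: "finite V"
    and V_nonempty: "V \<noteq> {}"
    and E_in_V: "E u v \<Longrightarrow> u \<in> V"
    and E_sym: "E u v \<Longrightarrow> E v u"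
    and E_irrefl: "\<not> E v v"
    and link_exists: "v \<in> V \<Longrightarrow> \<exists>xs. 2 \<le> length xs \<and> distinct xs \<and> set xs = {u. E v u} \<and>
      (\<forall>i < length xs. \<forall>j < length xs. E (xs ! i) (xs ! j) \<longleftrightarrow> j = Suc i \<or> i = Suc j)"
    and edge_out: "\<lbrakk>S \<subseteq> V; S \<noteq> {}; S \<noteq> V\<rbrakk> \<Longrightarrow> \<exists>u \<in> S. \<exists>w \<in> V - S. E u w"
begin

definition link :: "'a \<Rightarrow> 'a list \<Rightarrow> bool" where
  "link v xs \<longleftrightarrow> 2 \<le> length xs \<and> distinct xs \<and> set xs = {u. E v u} \<and>
     (\<forall>i < length xs. \<forall>j < length xs. E (xs ! i) (xs ! j) \<longleftrightarrow> j = Suc i \<or> i = Suc j)"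

definition bd :: "'a \<Rightarrow> 'a \<Rightarrow> bool" where
  "bd u v \<longleftrightarrow> E u v \<and> (\<exists>!w. E u w \<and> E v w)"

lemma E_in_V2: "E u v \<Longrightarrow> v \<in> V"
  using E_sym E_in_V by blast

lemma E_commute: "E u v \<longleftrightarrow> E v u"
  using E_sym by blast

lemma E_neq: "E u v \<Longrightarrow> u \<noteq> v"
  using E_irrefl by blast

lemma linkE:
  assumes "v \<in> V"
  obtains xs where "link v xs"
  using link_exists[OF assms] unfolding link_def by blast

lemma link_nth:
  assumes "link v xs" "i < length xs"
  shows "E v (xs ! i)"
  using assms unfolding link_def by (metis mem_Collect_eq nth_mem)

lemma link_adj:
  assumes "link v xs" "i < length xs" "j < length xs"
  shows "E (xs ! i) (xs ! j) \<longleftrightarrow> j = Suc i \<or> i = Suc j"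
  using assms unfolding link_def by blast

lemma link_index:
  assumes "link v xs" "E v u"
  obtains i where "i < length xs" "u = xs ! i"
  using assms unfolding link_def by (metis in_set_conv_nth mem_Collect_eq)

lemma link_eq_nth:
  assumes "link v xs" "i < length xs" "j < length xs"
  shows "xs ! i = xs ! j \<longleftrightarrow> i = j"
  using assms unfolding link_def by (simp add: nth_eq_iff_index_eq)

lemma bd_E: "bd u v \<Longrightarrow> E u v"
  unfolding bd_def by blast

lemma bd_sym: "bd u v \<Longrightarrow> bd v u"
  unfolding bd_def using E_sym by blast

lemma bd_apex_unique:
  "\<lbrakk>bd u v; E u w; E v w; E u w'; E v w'\<rbrakk> \<Longrightarrow> w = w'"
  unfolding bd_def by blast

lemma bd_apex: "bd u v \<Longrightarrow> \<exists>w. E u w \<and> E v w"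
  unfolding bd_def by blast

text \<open>The common neighbours of \<open>u\<close> and \<open>v\<close> are the neighbours of
  \<open>v\<close> in the path that forms the link of \<open>u\<close>.\<close>

lemma common_neighbours_le_2:
  assumes "E u v" "E u w1" "E v w1" "E u w2" "E v w2" "E u w3" "E v w3"
  shows "w1 = w2 \<or> w1 = w3 \<or> w2 = w3"
proof -
  obtain xs where xs: "link u xs" using linkE E_in_V[OF assms(1)] by blast
  obtain i where i: "i < length xs" "v = xs ! i" using link_index[OF xs assms(1)] .
  obtain i1 where i1: "i1 < length xs" "w1 = xs ! i1" using link_index[OF xs assms(2)] .
  obtain i2 where i2: "i2 < length xs" "w2 = xs ! i2" using link_index[OF xs assms(4)] .
  obtain i3 where i3: "i3 < length xs" "w3 = xs ! i3" using link_index[OF xs assms(6)] .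
  have "i1 = Suc i \<or> i = Suc i1" "i2 = Suc i \<or> i = Suc i2" "i3 = Suc i \<or> i = Suc i3"
    using link_adj[OF xs] i i1 i2 i3 assms by blast+
  then have "i1 = i2 \<or> i1 = i3 \<or> i2 = i3" by arith
  then show ?thesis using i1 i2 i3 by auto
qed

lemma common_neighbour:
  assumes "E u v"
  shows "\<exists>w. E u w \<and> E v w"
proof -
  obtain xs where xs: "link u xs" using linkE E_in_V[OF assms(1)] by blast
  obtain i where i: "i < length xs" "v = xs ! i" using link_index[OF xs assms(1)] .
  have l: "2 \<le> length xs" using xs unfolding link_def by blast
  show ?thesis
  proof (cases "Suc i < length xs")
    case True
    then show ?thesis using link_adj[OF xs i(1) True] link_nth[OF xs True] i by blast
  next
    case False
    then obtain j where j: "i = Suc j" using l i by (cases i) auto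
    then have "j < length xs" using i by simp
    then show ?thesis using link_adj[OF xs i(1), of j] link_nth[OF xs, of j] i j by blast
  qed
qed

lemma not_bd_common_neighbours:
  assumes "E u v" "\<not> bd u v"
  obtains w w' where "w \<noteq> w'" "E u w" "E v w" "E u w'" "E v w'"
  using common_neighbour[OF assms(1)] assms unfolding bd_def by blast

text \<open>Triangles on the edge from \<open>v\<close> to a link vertex correspond to the path
  neighbours of that vertex, and only the ends of a path have just one.\<close>

lemma link_bd:
  assumes xs: "link v xs" and i: "i < length xs"
  shows "bd v (xs ! i) \<longleftrightarrow> i = 0 \<or> Suc i = length xs"
proof
  assume b: "bd v (xs ! i)"
  show "i = 0 \<or> Suc i = length xs"
  proof (rule ccontr)
    assume "\<not> ?thesis"
    then obtain j where j: "i = Suc j" "Suc i < length xs" using i by (cases i) auto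
    have "E (xs ! i) (xs ! j)" "E (xs ! i) (xs ! Suc i)" using j link_adj[OF xs] by auto
    moreover have "E v (xs ! j)" "E v (xs ! Suc i)" using j link_nth[OF xs] by auto
    ultimately have "xs ! j = xs ! Suc i" using bd_apex_unique[OF b] by blast
    then show False using link_eq_nth[OF xs] j by auto
  qed
next
  assume e: "i = 0 \<or> Suc i = length xs"
  have "w = w'" if c: "E v w" "E (xs ! i) w" "E v w'" "E (xs ! i) w'" for w w'
  proof -
    obtain j where j: "j < length xs" "w = xs ! j" using link_index[OF xs c(1)] .
    obtain k where k: "k < length xs" "w' = xs ! k" using link_index[OF xs c(3)] .
    have "j = Suc i \<or> i = Suc j" "k = Suc i \<or> i = Suc k"
      using link_adj[OF xs i] j k c by blast+
    then show ?thesis using e j k by auto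
  qed
  then show "bd v (xs ! i)"
    unfolding bd_def using link_nth[OF xs i] common_neighbour by blast
qed

text \<open>These are the two ends of the link. Hence \<open>bd\<close> is 2-regular and decomposes
  into disjoint cycles.\<close>

lemma two_bd_neighbours:
  assumes "v \<in> V"
  obtains x y where "x \<noteq> y" "bd v x" "bd v y" "\<And>z. bd v z \<Longrightarrow> z = x \<or> z = y"
proof -
  obtain xs where xs: "link v xs" using linkE assms by blast
  have l: "2 \<le> length xs" using xs unfolding link_def by blast
  show thesis
  proof
    show "xs ! 0 \<noteq> xs ! (length xs - 1)" using link_eq_nth[OF xs, of 0 "length xs - 1"] l by (cases xs) auto
    show "bd v (xs ! 0)" "bd v (xs ! (length xs - 1))"
      using link_bd[OF xs, of 0] link_bd[OF xs, of "length xs - 1"] l by (cases xs; auto)+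
    fix z assume b: "bd v z"
    then obtain i where i: "i < length xs" "z = xs ! i" using link_index[OF xs bd_E] by blast
    have "i = 0 \<or> i = length xs - 1" using link_bd[OF xs i(1)] i b l by auto
    then show "z = xs ! 0 \<or> z = xs ! (length xs - 1)" using i by auto
  qed
qed

lemma bd_neighbours_le_2:
  assumes "bd v x" "bd v y" "bd v z"
  shows "x = y \<or> x = z \<or> y = z"
  using two_bd_neighbours[OF E_in_V[OF bd_E[OF assms(1)]]] assms by metis

text \<open>In a path, the vertex of \<open>S\<close> with least index has at most one neighbour in
  \<open>S\<close>, namely its successor.\<close>

lemma link_no_cycle:
  assumes S: "S \<noteq> {}" "\<And>x. x \<in> S \<Longrightarrow> E v x"
    and two: "\<And>x. x \<in> S \<Longrightarrow> \<exists>y \<in> S. \<exists>z \<in> S. y \<noteq> z \<and> E x y \<and> E x z"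
  shows False
proof -
  obtain x where "x \<in> S" using S by blast
  then have "v \<in> V" using S E_in_V by blast
  then obtain xs where xs: "link v xs" using linkE by blast
  define I where "I = {i. i < length xs \<and> xs ! i \<in> S}"
  have ind: "\<exists>i \<in> I. u = xs ! i" if "u \<in> S" for u
    using link_index[OF xs S(2)[OF that]] that unfolding I_def by blast
  have fin: "finite I" "I \<noteq> {}" unfolding I_def using ind[OF \<open>x \<in> S\<close>] I_def by auto
  define i where "i = Min I"
  have iI: "i \<in> I" and le: "\<And>j. j \<in> I \<Longrightarrow> i \<le> j" unfolding i_def using fin by auto
  obtain y z where yz: "y \<in> S" "z \<in> S" "y \<noteq> z" "E (xs ! i) y" "E (xs ! i) z"
    using two iI unfolding I_def by blast
  obtain j k where jk: "j \<in> I" "y = xs ! j" "k \<in> I" "z = xs ! k" using ind yz by blast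
  have "j = Suc i \<or> i = Suc j" "k = Suc i \<or> i = Suc k"
    using link_adj[OF xs] iI jk yz unfolding I_def by blast+
  then have "j = k" using le jk by fastforce
  then show False using jk yz by blast
qed

end

section \<open>Boundary cycles\<close>

definition cyclic_list :: "('a \<Rightarrow> 'a \<Rightarrow> bool) \<Rightarrow> 'a list \<Rightarrow> bool" where
  "cyclic_list R xs \<longleftrightarrow>
     distinct xs \<and> 3 \<le> length xs \<and> successively R xs \<and> R (last xs) (hd xs)"

lemma cyclic_list_mono:
  "\<lbrakk>cyclic_list R xs; \<And>x y. R x y \<Longrightarrow> Q x y\<rbrakk> \<Longrightarrow> cyclic_list Q xs"
  unfolding cyclic_list_def by (auto intro: successively_mono)

lemma cyclic_list_append_commute:
  assumes "cyclic_list R (xs @ ys)"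
  shows "cyclic_list R (ys @ xs)"
  using assms unfolding cyclic_list_def
  by (cases "xs = []"; cases "ys = []") (auto simp: successively_append_iff)

lemma cyclic_list_rev:
  assumes "cyclic_list R xs" "\<And>x y. R x y \<Longrightarrow> R y x"
  shows "cyclic_list R (rev xs)"
proof -
  have "successively (\<lambda>x y. R y x) xs"
    using assms unfolding cyclic_list_def by (auto intro: successively_mono)
  then show ?thesis
    using assms unfolding cyclic_list_def by (auto simp: successively_rev hd_rev last_rev)
qed

lemma cyclic_list_start:
  assumes "cyclic_list R xs" "x \<in> set xs"
  obtains ys where "cyclic_list R (x # ys)" "set (x # ys) = set xs" "length (x # ys) = length xs"
proof -
  obtain as bs where "xs = as @ x # bs" using split_list[OF assms(2)] by blast
  then show thesis
    using that[of "bs @ as"] cyclic_list_append_commute[of R as "x # bs"] assms(1) by auto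
qed

lemma cyclic_list_nth_mod:
  assumes "cyclic_list R xs"
  shows "R (xs ! (i mod length xs)) (xs ! (Suc i mod length xs))"
proof (cases "Suc (i mod length xs) = length xs")
  case True
  then have "Suc i mod length xs = 0" "i mod length xs = length xs - 1" by (auto simp: mod_Suc)
  moreover have "xs \<noteq> []" using True by auto
  ultimately show ?thesis
    using assms unfolding cyclic_list_def by (metis hd_conv_nth last_conv_nth)
next
  case False
  have "0 < length xs" using assms unfolding cyclic_list_def by linarith
  then have "Suc (i mod length xs) < length xs" "Suc i mod length xs = Suc (i mod length xs)"
    using False by (auto simp: mod_Suc Suc_lessI)
  then show ?thesis using assms unfolding cyclic_list_def by (simp add: successively_conv_nth)
qed

context locally_linear_graph
begin

definition ladder_free :: "'a set \<Rightarrow> 'a set \<Rightarrow> bool" where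
  "ladder_free A B \<longleftrightarrow> (\<forall>x \<in> A. \<forall>x' \<in> A. \<forall>y \<in> B. \<forall>y' \<in> B.
     \<not> (bd x x' \<and> bd y y' \<and> E x y \<and> E x' y'))"

text \<open>Take a longest boundary path from \<open>v\<close>. Both boundary neighbours of its last
  vertex lie on it, and only the predecessor and \<open>v\<close> have a boundary edge to
  spare.\<close>

lemma bd_cycle_exists:
  assumes v: "v \<in> V"
  obtains xs where "cyclic_list bd xs" "v \<in> set xs" "set xs \<subseteq> V"
proof -
  define P where "P xs \<longleftrightarrow> distinct xs \<and> xs \<noteq> [] \<and> hd xs = v \<and> successively bd xs \<and> set xs \<subseteq> V" for xs
  have P0: "P [v]" unfolding P_def using v by auto
  have bound: "\<forall>xs. P xs \<longrightarrow> length xs \<le> card V"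
    unfolding P_def using finite_V by (metis card_mono distinct_card)
  obtain xs where xs: "P xs" and longest: "\<And>ys. P ys \<Longrightarrow> length ys \<le> length xs"
    using ex_has_greatest_nat[of P "[v]" length "Suc (card V)"] P0 bound by (metis le_imp_less_Suc)
  define z where "z = last xs"
  have ne: "xs \<noteq> []" and d: "distinct xs" and s: "successively bd xs" and sub: "set xs \<subseteq> V"
    and h: "hd xs = v" using xs unfolding P_def by auto
  have zV: "z \<in> V" using ne sub unfolding z_def by auto
  have inside: "y \<in> set xs" if "bd z y" for y
  proof (rule ccontr)
    assume "y \<notin> set xs"
    then have "P (xs @ [y])"
      using xs that E_in_V2[OF bd_E[OF that]] unfolding P_def z_def
      by (auto simp: successively_append_iff)
    then show False using longest by fastforce
  qed
  have step: "bd (xs ! i) (xs ! Suc i)" if "Suc i < length xs" for i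
    using s that successively_conv_nth by blast
  have z_nth: "z = xs ! (length xs - 1)" unfolding z_def using ne by (rule last_conv_nth)
  have only: "y = v \<or> y = xs ! (length xs - 2)" if y: "bd z y" for y
  proof (rule ccontr)
    assume n: "\<not> ?thesis"
    obtain i where i: "i < length xs" "y = xs ! i" using inside[OF y] by (metis in_set_conv_nth)
    have "i \<noteq> 0" using n i h ne by (metis hd_conv_nth)
    moreover have "i \<noteq> length xs - 2" using n i by auto
    moreover have "i \<noteq> length xs - 1" using y z_nth i E_neq[OF bd_E[OF y]] by auto
    ultimately obtain j where j: "i = Suc j" "Suc i < length xs - 1" using i by (cases i) auto
    \<comment> \<open>An inner vertex \<open>y\<close> already has its two path neighbours as
      boundary neighbours, so \<open>z\<close> would be a third.\<close>
    have "bd y (xs ! j)" using step[of j] j i bd_sym by auto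
    moreover have "bd y (xs ! Suc i)" using step[of i] j i by auto
    ultimately have "xs ! j = xs ! Suc i \<or> xs ! j = z \<or> xs ! Suc i = z"
      using bd_neighbours_le_2 bd_sym[OF y] by blast
    then show False using d j unfolding z_nth by (auto simp: nth_eq_iff_index_eq)
  qed
  obtain x y where xy: "x \<noteq> y" "bd z x" "bd z y" using two_bd_neighbours[OF zV] by metis
  have diff: "v \<noteq> xs ! (length xs - 2)" using only[OF xy(2)] only[OF xy(3)] xy(1) by auto
  then have bv: "bd z v" using only[OF xy(2)] only[OF xy(3)] xy by metis
  have "3 \<le> length xs"
  proof (rule ccontr)
    assume "\<not> ?thesis"
    then have "length xs - 2 = 0" by simp
    then show False using diff h ne by (metis hd_conv_nth)
  qed
  then have "cyclic_list bd xs" unfolding cyclic_list_def using d s bv h z_def by auto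
  then show thesis using that sub h ne by auto
qed

text \<open>The two cycle neighbours of \<open>x\<close> exhaust its boundary edges, so a boundary
  cycle is a whole component of \<open>bd\<close>.\<close>

lemma bd_cycle_closed:
  assumes "cyclic_list bd xs" "x \<in> set xs" "bd x y"
  shows "y \<in> set xs"
proof -
  obtain ys where ys: "cyclic_list bd (x # ys)" "set (x # ys) = set xs"
    using cyclic_list_start[OF assms(1,2)] by metis
  have l: "2 \<le> length ys" using ys(1) unfolding cyclic_list_def by auto
  then obtain a b zs where z: "ys = a # zs @ [b]"
    by (cases ys; cases "tl ys" rule: rev_cases) auto
  then have "bd x a" "bd x b" "a \<noteq> b" using ys(1) bd_sym unfolding cyclic_list_def by auto
  then have "y = a \<or> y = b" using bd_neighbours_le_2 assms(3) by metis
  then show ?thesis using ys(2) z by auto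
qed

lemma bd_cycle_through_edge:
  assumes "cyclic_list bd xs" "x \<in> set xs" "bd x x'"
  obtains ys where "cyclic_list bd ys" "set ys = set xs" "hd ys = x" "last ys = x'"
proof -
  obtain zs where zs: "cyclic_list bd (x # zs)" "set (x # zs) = set xs"
    using cyclic_list_start[OF assms(1,2)] by metis
  have l: "2 \<le> length zs" using zs(1) unfolding cyclic_list_def by auto
  then obtain a b ys where z: "zs = a # ys @ [b]"
    by (cases zs; cases "tl zs" rule: rev_cases) auto
  then have "bd x a" "bd x b" "a \<noteq> b" using zs(1) bd_sym unfolding cyclic_list_def by auto
  then consider "x' = a" | "x' = b" using bd_neighbours_le_2 assms(3) by metis
  then show thesis
  proof cases
    case 1
    have "cyclic_list bd (zs @ [x])" using cyclic_list_append_commute[of bd "[x]" zs] zs(1) by simp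
    then have "cyclic_list bd (rev (zs @ [x]))" using cyclic_list_rev bd_sym by blast
    then show ?thesis using that[of "rev (zs @ [x])"] zs(2) z 1 by auto
  next
    case 2
    then show ?thesis using that[of "x # zs"] zs z by auto
  qed
qed

text \<open>Removing \<open>x x'\<close> and \<open>y y'\<close> opens the cycles into two paths,
  whose ends are joined by \<open>x y\<close> and \<open>x' y'\<close>.\<close>

lemma ladder_hamiltonian:
  assumes A: "cyclic_list bd as" and B: "cyclic_list bd bs"
    and disj: "set as \<inter> set bs = {}"
    and ladder: "\<not> ladder_free (set as) (set bs)"
  obtains xs where "cyclic_list E xs" "set xs = set as \<union> set bs"
proof -
  obtain x x' y y' where l: "x \<in> set as" "x' \<in> set as" "y \<in> set bs" "y' \<in> set bs"
    "bd x x'" "bd y y'" "E x y" "E x' y'"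
    using ladder unfolding ladder_free_def by blast
  obtain us where us: "cyclic_list bd us" "set us = set as" "hd us = x'" "last us = x"
    using bd_cycle_through_edge[OF A l(2) bd_sym[OF l(5)]] .
  obtain ws where ws: "cyclic_list bd ws" "set ws = set bs" "hd ws = y" "last ws = y'"
    using bd_cycle_through_edge[OF B l(3,6)] .
  have su: "successively E us" "successively E ws"
    using us(1) ws(1) unfolding cyclic_list_def by (auto intro: successively_mono bd_E)
  have "us \<noteq> []" "ws \<noteq> []" using us(1) ws(1) unfolding cyclic_list_def by auto
  then have "cyclic_list E (us @ ws)"
    using us ws su l disj E_sym unfolding cyclic_list_def
    by (auto simp: successively_append_iff)
  then show thesis using that us ws by auto
qed

text \<open>Both \<open>v\<close> and \<open>w\<close> are ends of the path that is the link of
  \<open>u\<close>, yet they are adjacent; so the path has no other vertex and \<open>u\<close> is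
  an ear of degree 2.\<close>

lemma ear_neighbours:
  assumes "bd u v" "bd u w" "E v w" "E u z"
  shows "z = v \<or> z = w"
proof -
  obtain xs where xs: "link u xs" using linkE E_in_V[OF assms(4)] by blast
  obtain i where i: "i < length xs" "v = xs ! i" using link_index[OF xs bd_E[OF assms(1)]] .
  obtain j where j: "j < length xs" "w = xs ! j" using link_index[OF xs bd_E[OF assms(2)]] .
  obtain k where k: "k < length xs" "z = xs ! k" using link_index[OF xs assms(4)] .
  have "i = 0 \<or> Suc i = length xs" "j = 0 \<or> Suc j = length xs" "j = Suc i \<or> i = Suc j"
    using link_bd[OF xs] link_adj[OF xs] i j assms by auto
  then have "k = i \<or> k = j" using k i j by auto
  then show ?thesis using i j k by auto
qed

text \<open>Each corner is an ear, so no edge leaves the triangle.\<close>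

lemma bd_triangle:
  assumes b: "bd x y" "bd y z" "bd z x"
  shows "V = {x, y, z}"
proof (rule ccontr)
  assume "V \<noteq> {x, y, z}"
  moreover have "{x, y, z} \<subseteq> V" using b bd_E E_in_V by blast
  ultimately obtain u w where u: "u \<in> {x, y, z}" "w \<in> V - {x, y, z}" "E u w"
    using edge_out[of "{x, y, z}"] by blast
  then show False
    using ear_neighbours[of x y z w] ear_neighbours[of y x z w] ear_neighbours[of z x y w]
      b bd_sym bd_E by blast
qed

lemma bd_cycle_length:
  assumes xs: "cyclic_list bd xs" "set xs \<subset> V"
  shows "4 \<le> length xs"
proof (rule ccontr)
  assume "\<not> ?thesis"
  then have "length xs = Suc (Suc (Suc 0))" using xs unfolding cyclic_list_def by auto
  then obtain x y z where e: "xs = [x, y, z]" by (auto simp: length_Suc_conv)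
  then have "V = {x, y, z}" using xs(1) unfolding cyclic_list_def by (intro bd_triangle) auto
  then show False using xs(2) e by auto
qed

end

section \<open>Two boundary cycles\<close>

locale two_boundary_cycles = locally_linear_graph +
  fixes as bs :: "'a list"
  assumes A_cycle: "cyclic_list bd as" and B_cycle: "cyclic_list bd bs"
    and disjoint: "set as \<inter> set bs = {}" and cover: "set as \<union> set bs = V"
    and no_ladder: "ladder_free (set as) (set bs)"
begin

abbreviation "A \<equiv> set as"
abbreviation "B \<equiv> set bs"

text \<open>The last two conjuncts put a triangle with apex in \<open>A\<close> on each chord. An
  edge lies in at most two triangles, so each chord has at most one apex in \<open>B\<close>; this
  restricts how chords of \<open>B\<close> can lie.\<close>

definition wedge :: "'a \<Rightarrow> 'a \<Rightarrow> 'a \<Rightarrow> bool" where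
  "wedge c p q \<longleftrightarrow> c \<in> B \<and> p \<in> B \<and> q \<in> B \<and> p \<noteq> q \<and> \<not> E p q \<and>
     E c p \<and> \<not> bd c p \<and> E c q \<and> \<not> bd c q \<and>
     (\<exists>a \<in> A. E c a \<and> E p a) \<and> (\<exists>a \<in> A. E c a \<and> E q a)"

section \<open>Edges between the two cycles and the existence of wedges\<close>

lemma not_B_iff: "v \<in> V \<Longrightarrow> v \<notin> B \<longleftrightarrow> v \<in> A"
  using disjoint cover by blast

lemma ladder:
  "\<lbrakk>x \<in> A; x' \<in> A; y \<in> B; y' \<in> B; bd x x'; E x y; E x' y'\<rbrakk> \<Longrightarrow> \<not> bd y y'"
  using no_ladder unfolding ladder_free_def by blast

lemma mixed_not_bd:
  assumes "x \<in> A" "y \<in> B"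
  shows "\<not> bd x y" "\<not> bd y x"
  using bd_cycle_closed[OF A_cycle assms(1)] bd_sym assms(2) disjoint by blast+

text \<open>Edges between \<open>A\<close> and \<open>B\<close> are not boundary edges, so each has
  two apexes. If all those at \<open>v\<close> were in \<open>B\<close>, the neighbours of
  \<open>v\<close> in \<open>B\<close> would each have two neighbours among themselves, impossible
  in a path.\<close>

lemma mixed_triangle:
  assumes v: "v \<in> A" and b: "b \<in> B" "E v b"
  shows "\<exists>x \<in> A. \<exists>y \<in> B. E v x \<and> E v y \<and> E x y"
proof (rule ccontr)
  assume n: "\<not> ?thesis"
  define S where "S = {u \<in> B. E v u}"
  show False
  proof (rule link_no_cycle[of S v])
    show "S \<noteq> {}" using b S_def by blast
    show "E v x" if "x \<in> S" for x using that S_def by blast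
    fix x assume x: "x \<in> S"
    have xB: "x \<in> B" "E v x" using x S_def by auto
    obtain w w' where w: "w \<noteq> w'" "E v w" "E x w" "E v w'" "E x w'"
      using not_bd_common_neighbours[OF xB(2)] mixed_not_bd(1)[OF v xB(1)] by metis
    have "w \<in> B" "w' \<in> B" using n xB w E_in_V2 not_B_iff E_sym by metis+
    then show "\<exists>y\<in>S. \<exists>z\<in>S. y \<noteq> z \<and> E x y \<and> E x z" using w S_def by blast
  qed
qed

text \<open>The ends of the link of \<open>c\<close> are its boundary neighbours and lie in
  \<open>B\<close>, so \<open>B\<close> is met on both sides of \<open>x x'\<close>. By
  \<open>rim\<close> the edges of \<open>A\<close> in this link are boundary edges, as a ladder
  needs.\<close>

lemma wedge_exists:
  assumes c: "c \<in> B" and x: "x \<in> A" "x' \<in> A" "E c x" "E c x'" "E x x'"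
    and rim: "\<And>u u'. \<lbrakk>u \<in> A; u' \<in> A; E c u; E c u'; E u u'\<rbrakk> \<Longrightarrow> bd u u'"
  shows "\<exists>p q. wedge c p q"
proof -
  have cV: "c \<in> V" using c cover by blast
  obtain xs where xs: "link c xs" using linkE[OF cV] by blast
  let ?n = "length xs"
  have n2: "2 \<le> ?n" using xs unfolding link_def by blast
  obtain i0 where i0: "i0 < ?n" "x = xs ! i0" using link_index[OF xs x(3)] .
  obtain i1 where i1: "i1 < ?n" "x' = xs ! i1" using link_index[OF xs x(4)] .
  have "i1 = Suc i0 \<or> i0 = Suc i1" using link_adj[OF xs] i0 i1 x(5) by blast
  then obtain i where i: "Suc i < ?n" "xs ! i \<in> A" "xs ! Suc i \<in> A"
    using i0 i1 x by auto
  have AB: "xs ! k \<in> A \<longleftrightarrow> xs ! k \<notin> B" if "k < ?n" for k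
    using not_B_iff[OF E_in_V2[OF link_nth[OF xs that]]] by blast
  have endB: "xs ! k \<in> B" if "k = 0 \<or> k = ?n - 1" for k
  proof -
    have "k < ?n" "k = 0 \<or> Suc k = ?n" using that n2 by auto
    then have "bd c (xs ! k)" using link_bd[OF xs] by blast
    then show ?thesis using bd_cycle_closed[OF B_cycle c] by blast
  qed
  \<comment> \<open>the first vertices of \<open>B\<close> on either side of \<open>x x'\<close> in the link of \<open>c\<close>; the vertices of \<open>A\<close>
    between them give ladders unless both are joined to \<open>c\<close> by chords\<close>
  define J where "J = {j. j < i \<and> xs ! j \<in> B}"
  define K where "K = {k. Suc i < k \<and> k < ?n \<and> xs ! k \<in> B}"
  have "i \<noteq> 0" using endB AB i Suc_lessD by metis
  then have J: "finite J" "J \<noteq> {}" using endB[of 0] unfolding J_def by auto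
  have "Suc i \<noteq> ?n - 1" using endB AB i by metis
  then have "?n - 1 \<in> K" using endB[of "?n - 1"] i unfolding K_def by auto
  then have K: "finite K" "K \<noteq> {}" unfolding K_def by auto
  define j where "j = Max J"
  define k where "k = Min K"
  have jJ: "j \<in> J" and jmax: "\<And>l. l \<in> J \<Longrightarrow> l \<le> j" unfolding j_def using J by auto
  have kK: "k \<in> K" and kmin: "\<And>l. l \<in> K \<Longrightarrow> k \<le> l" unfolding k_def using K by auto
  have j: "j < i" "xs ! j \<in> B" using jJ unfolding J_def by auto
  have k: "Suc i < k" "k < ?n" "xs ! k \<in> B" using kK unfolding K_def by auto
  have run: "xs ! l \<in> A" if l: "j < l" "l < k" for l
  proof -
    have ln: "l < ?n" using l k by simp
    consider "l < i" | "l = i" | "l = Suc i" | "Suc i < l" by linarith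
    then show ?thesis
    proof cases
      case 1
      then have "l \<notin> J" using jmax[of l] l by auto
      then show ?thesis using 1 AB[OF ln] unfolding J_def by auto
    next
      case 4
      then have "l \<notin> K" using kmin[of l] l by auto
      then show ?thesis using 4 AB[OF ln] ln unfolding K_def by auto
    qed (use i in auto)
  qed
  have adj: "E (xs ! l) (xs ! Suc l)" if "Suc l < ?n" for l using link_adj[OF xs] that by auto
  have nb: "E c (xs ! l)" if "l < ?n" for l using link_nth[OF xs] that by auto
  have rbd: "bd (xs ! l) (xs ! Suc l)" if "j < l" "Suc l < k" for l
    using that k run[of l] run[of "Suc l"] by (intro rim adj nb) auto
  \<comment> \<open>\<open>k'\<close> is the last but one vertex of the run, so the ladder at
    \<open>k\<close> can be read backwards.\<close>
  obtain k' where k': "k = Suc (Suc k')" using k by (cases k; cases "k - 1") auto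
  have l1: "j < k'" using k' k j by auto
  have p: "\<not> bd (xs ! j) c"
  proof (rule ladder)
    show "xs ! Suc j \<in> A" "xs ! Suc (Suc j) \<in> A" using run l1 k' by auto
    show "bd (xs ! Suc j) (xs ! Suc (Suc j))" using rbd l1 k' by auto
    show "E (xs ! Suc j) (xs ! j)" using adj[of j] E_sym k j by auto
    show "E (xs ! Suc (Suc j)) c" using nb[of "Suc (Suc j)"] E_sym k j k' by auto
  qed (use j c in auto)
  have q: "\<not> bd (xs ! k) c"
  proof (rule ladder)
    show "xs ! Suc k' \<in> A" "xs ! k' \<in> A" using run l1 k' by auto
    show "bd (xs ! Suc k') (xs ! k')" using rbd[of k'] l1 k' bd_sym by auto
    show "E (xs ! Suc k') (xs ! k)" using adj[of "Suc k'"] k k' by auto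
    show "E (xs ! k') c" using nb[of k'] E_sym k k' by auto
  qed (use k c in auto)
  have "wedge c (xs ! j) (xs ! k)"
    unfolding wedge_def
  proof (intro conjI bexI)
    show "xs ! j \<noteq> xs ! k" using link_eq_nth[OF xs] j k by auto
    show "\<not> E (xs ! j) (xs ! k)" using link_adj[OF xs, of j k] j k by auto
    show "E c (xs ! j)" "E c (xs ! k)" using nb j k by auto
    show "\<not> bd c (xs ! j)" "\<not> bd c (xs ! k)" using p q bd_sym by blast+
    show "xs ! Suc j \<in> A" "xs ! Suc k' \<in> A" using run l1 k' by auto
    show "E c (xs ! Suc j)" "E c (xs ! Suc k')" using nb l1 k' k by auto
    show "E (xs ! j) (xs ! Suc j)" using adj[of j] l1 k k' by auto
    show "E (xs ! k) (xs ! Suc k')" using adj[of "Suc k'"] E_sym k k' by auto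
  qed (use c j k in auto)
  then show ?thesis by blast
qed

lemma wedge_sym: "wedge c p q \<Longrightarrow> wedge c q p"
  unfolding wedge_def using E_sym by blast

lemma wedge_common:
  assumes "wedge c p q" "y \<in> B" "y' \<in> B" "E c y" "E p y" "E c y'" "E p y'"
  shows "y = y'"
  using assms common_neighbours_le_2[of c p y y'] disjoint unfolding wedge_def by blast

section \<open>Wedges in a boundary cycle of 6 or 7 vertices\<close>

lemma ear_isolated:
  assumes "bd u v" "bd v w" "E u w" "z \<noteq> u" "z \<noteq> w"
  shows "\<not> E v z"
  using ear_neighbours[of v u w z] assms bd_sym by blast

lemma wedge_start:
  assumes "wedge c p q"
  obtains ys where "cyclic_list bd (c # ys)" "B = set (c # ys)" "length bs = Suc (length ys)"
  using cyclic_list_start[OF B_cycle] assms unfolding wedge_def by (metis length_Cons)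

text \<open>The skipped vertex \<open>y\<close> is already the one apex in \<open>B\<close> that the
  chord \<open>c p\<close> may have.\<close>

lemma wedge_span_2:
  assumes "wedge c p q" "bd c y" "bd y p" "k \<in> B" "E c k" "k \<noteq> y"
  shows "\<not> E p k"
proof -
  have "y \<in> B" using bd_cycle_closed[OF B_cycle _ assms(2)] assms(1) unfolding wedge_def by blast
  then show ?thesis using wedge_common[OF assms(1), of y k] assms(2-6) bd_E bd_sym by blast
qed

text \<open>\<open>p\<close> and \<open>q\<close> avoid \<open>c\<close> and its two cycle
  neighbours, and being nonadjacent they are separated by a sixth vertex.\<close>

lemma wedge_length:
  assumes "wedge c p q"
  shows "6 \<le> length bs"
proof (rule ccontr)
  assume s: "\<not> ?thesis"
  obtain ys where ys: "cyclic_list bd (c # ys)" "B = set (c # ys)" "length bs = Suc (length ys)"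
    using wedge_start[OF assms] .
  have w: "p \<in> B" "q \<in> B" "p \<noteq> q" "\<not> E p q" "p \<noteq> c" "q \<noteq> c" "\<not> bd c p" "\<not> bd c q"
    using assms E_irrefl unfolding wedge_def by blast+
  have l: "2 \<le> length ys" "length ys < 5" using ys s unfolding cyclic_list_def by auto
  consider y1 y2 where "ys = [y1, y2]" | y1 y2 y3 where "ys = [y1, y2, y3]"
    | y1 y2 y3 y4 where "ys = [y1, y2, y3, y4]"
    using l by (cases ys; cases "tl ys"; cases "tl (tl ys)"; cases "tl (tl (tl ys))";
        cases "tl (tl (tl (tl ys)))") auto
  then show False
  proof cases
    case 1
    then show ?thesis using ys w bd_sym unfolding cyclic_list_def by auto
  next
    case 2
    then show ?thesis using ys w bd_sym unfolding cyclic_list_def by auto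
  next
    case 3
    then show ?thesis using ys w bd_sym bd_E E_sym unfolding cyclic_list_def by auto
  qed
qed

text \<open>\<open>y2\<close> and \<open>y4\<close> are the only nonconsecutive pair among
  \<open>y2\<close>, \<open>y3\<close>, \<open>y4\<close>. The chord \<open>y0 y2\<close> has its
  apex \<open>y1\<close> in \<open>B\<close>, so \<open>y3\<close> cannot be a second one.\<close>

lemma wedge_in_6_cycle:
  assumes "wedge y0 p q" and ys: "cyclic_list bd [y0, y1, y2, y3, y4, y5]"
    "B = set [y0, y1, y2, y3, y4, y5]"
  shows "E y0 y2 \<and> E y0 y4 \<and> \<not> E y2 y4 \<and> \<not> E y0 y3"
proof -
  have w: "p \<in> B" "q \<in> B" "p \<noteq> q" "\<not> E p q" "p \<noteq> y0" "q \<noteq> y0" "\<not> bd y0 p" "\<not> bd y0 q"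
    "E y0 p" "E y0 q"
    using assms(1) E_irrefl unfolding wedge_def by blast+
  have b: "bd y0 y1" "bd y1 y2" "bd y2 y3" "bd y3 y4" "bd y4 y5" "bd y5 y0"
    and d: "distinct [y0, y1, y2, y3, y4, y5]"
    using ys(1) unfolding cyclic_list_def by auto
  have "p \<in> {y2, y3, y4}" "q \<in> {y2, y3, y4}" using w ys(2) b bd_sym by auto
  then have pq: "p = y2 \<and> q = y4 \<or> p = y4 \<and> q = y2" using w b bd_E E_sym by auto
  then have "wedge y0 y2 y4" using assms(1) wedge_sym by blast
  then have "\<not> E y0 y3" using wedge_span_2[of y0 y2 y4 y1 y3] b d ys(2) bd_E by auto
  then show ?thesis using pq w E_sym by blast
qed

text \<open>The chord \<open>y0 y2\<close> makes \<open>y1\<close> an ear. A wedge at any other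
  vertex would need a chord at \<open>y1\<close> or the missing chord \<open>y2 y4\<close>.\<close>

lemma wedge_unique_6:
  assumes "wedge y0 p q" "wedge c p' q'"
    and ys: "cyclic_list bd [y0, y1, y2, y3, y4, y5]" "B = set [y0, y1, y2, y3, y4, y5]"
  shows "c = y0"
proof (rule ccontr)
  assume "c \<noteq> y0"
  then have c: "c \<in> {y1, y2, y3, y4, y5}" using assms(2) ys(2) unfolding wedge_def by auto
  have b: "bd y0 y1" "bd y1 y2" "bd y2 y3" "bd y3 y4" "bd y4 y5" "bd y5 y0"
    and d: "distinct [y0, y1, y2, y3, y4, y5]"
    using ys(1) unfolding cyclic_list_def by auto
  have 0: "E y0 y2" "E y0 y4" "\<not> E y2 y4" using wedge_in_6_cycle[OF assms(1) ys] by auto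
  have ear: "\<not> E y1 y3" "\<not> E y1 y5" using ear_isolated[OF b(1,2) 0(1)] d by auto
  have rot: "cyclic_list bd [y1, y2, y3, y4, y5, y0]" "cyclic_list bd [y2, y3, y4, y5, y0, y1]"
    "cyclic_list bd [y3, y4, y5, y0, y1, y2]" "cyclic_list bd [y4, y5, y0, y1, y2, y3]"
    "cyclic_list bd [y5, y0, y1, y2, y3, y4]"
    using b d unfolding cyclic_list_def by auto
  have "B = set [y1, y2, y3, y4, y5, y0]" "B = set [y2, y3, y4, y5, y0, y1]"
    "B = set [y3, y4, y5, y0, y1, y2]" "B = set [y4, y5, y0, y1, y2, y3]"
    "B = set [y5, y0, y1, y2, y3, y4]"
    using ys(2) by auto
  note r = wedge_in_6_cycle[OF _ rot(1) this(1)] wedge_in_6_cycle[OF _ rot(2) this(2)]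
    wedge_in_6_cycle[OF _ rot(3) this(3)] wedge_in_6_cycle[OF _ rot(4) this(4)]
    wedge_in_6_cycle[OF _ rot(5) this(5)]
  show False using c r assms(2) 0 ear E_sym by blast
qed

text \<open>There are three nonconsecutive pairs among \<open>y2\<close> to \<open>y5\<close>. The
  further non-edges come from \<open>wedge_span_2\<close>, applied to the chords
  \<open>y0 y2\<close> and \<open>y0 y5\<close> that skip one vertex.\<close>

lemma wedge_in_7_cycle:
  assumes "wedge y0 p q" and ys: "cyclic_list bd [y0, y1, y2, y3, y4, y5, y6]"
    "B = set [y0, y1, y2, y3, y4, y5, y6]"
  shows "E y0 y2 \<and> E y0 y4 \<and> \<not> E y2 y4 \<and> \<not> E y0 y3 \<and> \<not> E y2 y6
    \<or> E y0 y2 \<and> E y0 y5 \<and> \<not> E y2 y5 \<and> \<not> E y0 y3 \<and> \<not> E y0 y4 \<and> \<not> E y2 y6 \<and> \<not> E y1 y5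
    \<or> E y0 y3 \<and> E y0 y5 \<and> \<not> E y3 y5 \<and> \<not> E y0 y4 \<and> \<not> E y1 y5"
proof -
  have w: "p \<in> B" "q \<in> B" "p \<noteq> q" "\<not> E p q" "p \<noteq> y0" "q \<noteq> y0" "\<not> bd y0 p" "\<not> bd y0 q"
    "E y0 p" "E y0 q"
    using assms(1) E_irrefl unfolding wedge_def by blast+
  have b: "bd y0 y1" "bd y1 y2" "bd y2 y3" "bd y3 y4" "bd y4 y5" "bd y5 y6" "bd y6 y0"
    and d: "distinct [y0, y1, y2, y3, y4, y5, y6]"
    using ys(1) unfolding cyclic_list_def by auto
  have e: "E y0 y1" "E y2 y3" "E y5 y4" "E y0 y6" using b bd_E bd_sym by blast+
  have "p \<in> {y2, y3, y4, y5}" "q \<in> {y2, y3, y4, y5}" using w ys(2) b bd_sym by auto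
  then have pq: "{p, q} = {y2, y4} \<or> {p, q} = {y2, y5} \<or> {p, q} = {y3, y5}"
    using w b bd_E E_sym by auto
  have two: "\<not> E y0 y3 \<and> \<not> E y2 y6" if "wedge y0 y2 r" for r
    using wedge_span_2[OF that b(1,2), of y3] wedge_span_2[OF that b(1,2), of y6] e d ys(2) by auto
  have five: "\<not> E y0 y4 \<and> \<not> E y1 y5" if "wedge y0 y5 r" for r
    using wedge_span_2[OF that bd_sym[OF b(7)] bd_sym[OF b(6)], of y4]
      wedge_span_2[OF that bd_sym[OF b(7)] bd_sym[OF b(6)], of y1] e d ys(2) E_sym by auto
  have "wedge y0 y2 y4 \<or> wedge y0 y2 y5 \<or> wedge y0 y3 y5"
    using pq assms(1) wedge_sym by (auto simp: doubleton_eq_iff)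
  then consider "wedge y0 y2 y4" | "wedge y0 y2 y5" | "wedge y0 y3 y5" by blast
  then show ?thesis
  proof cases
    case 1
    then show ?thesis using two[OF 1] unfolding wedge_def by blast
  next
    case 2
    then show ?thesis using two[OF 2] five[OF wedge_sym[OF 2]] unfolding wedge_def by blast
  next
    case 3
    then show ?thesis using five[OF wedge_sym[OF 3]] unfolding wedge_def by blast
  qed
qed

text \<open>A propositional check: the possible shapes of both wedges are combined with the fact
  that a chord skipping one vertex makes that vertex an ear.\<close>

lemma wedge_pair_7:
  assumes "wedge y0 p q" "wedge c p' q'" "c \<noteq> y0"
    and ys: "cyclic_list bd [y0, y1, y2, y3, y4, y5, y6]" "B = set [y0, y1, y2, y3, y4, y5, y6]"
  shows "c = y2 \<and> E y0 y2 \<or> c = y5 \<and> E y0 y5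
    \<or> c = y6 \<and> E y0 y2 \<and> E y0 y4 \<or> c = y1 \<and> E y0 y5 \<and> E y0 y3"
proof -
  have c: "c \<in> {y1, y2, y3, y4, y5, y6}" using assms(2,3) ys(2) unfolding wedge_def by auto
  have b: "bd y0 y1" "bd y1 y2" "bd y2 y3" "bd y3 y4" "bd y4 y5" "bd y5 y6" "bd y6 y0"
    and d: "distinct [y0, y1, y2, y3, y4, y5, y6]"
    using ys(1) unfolding cyclic_list_def by auto
  have ear: "E y0 y2 \<longrightarrow> \<not> E y1 y3 \<and> \<not> E y1 y4 \<and> \<not> E y1 y5 \<and> \<not> E y1 y6"
    "E y1 y3 \<longrightarrow> \<not> E y2 y4 \<and> \<not> E y2 y5 \<and> \<not> E y2 y6 \<and> \<not> E y2 y0"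
    "E y2 y4 \<longrightarrow> \<not> E y3 y5 \<and> \<not> E y3 y6 \<and> \<not> E y3 y0 \<and> \<not> E y3 y1"
    "E y3 y5 \<longrightarrow> \<not> E y4 y6 \<and> \<not> E y4 y0 \<and> \<not> E y4 y1 \<and> \<not> E y4 y2"
    "E y4 y6 \<longrightarrow> \<not> E y5 y0 \<and> \<not> E y5 y1 \<and> \<not> E y5 y2 \<and> \<not> E y5 y3"
    "E y5 y0 \<longrightarrow> \<not> E y6 y1 \<and> \<not> E y6 y2 \<and> \<not> E y6 y3 \<and> \<not> E y6 y4"
    "E y6 y1 \<longrightarrow> \<not> E y0 y2 \<and> \<not> E y0 y3 \<and> \<not> E y0 y4 \<and> \<not> E y0 y5"
    using ear_isolated[OF b(1,2)] ear_isolated[OF b(2,3)] ear_isolated[OF b(3,4)]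
      ear_isolated[OF b(4,5)] ear_isolated[OF b(5,6)] ear_isolated[OF b(6,7)]
      ear_isolated[OF b(7,1)] d by auto
  have rot: "cyclic_list bd [y1, y2, y3, y4, y5, y6, y0]"
    "cyclic_list bd [y2, y3, y4, y5, y6, y0, y1]" "cyclic_list bd [y3, y4, y5, y6, y0, y1, y2]"
    "cyclic_list bd [y4, y5, y6, y0, y1, y2, y3]" "cyclic_list bd [y5, y6, y0, y1, y2, y3, y4]"
    "cyclic_list bd [y6, y0, y1, y2, y3, y4, y5]"
    using b d unfolding cyclic_list_def by auto
  have st: "B = set [y1, y2, y3, y4, y5, y6, y0]" "B = set [y2, y3, y4, y5, y6, y0, y1]"
    "B = set [y3, y4, y5, y6, y0, y1, y2]" "B = set [y4, y5, y6, y0, y1, y2, y3]"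
    "B = set [y5, y6, y0, y1, y2, y3, y4]" "B = set [y6, y0, y1, y2, y3, y4, y5]"
    using ys(2) by auto
  \<comment> \<open>One orientation is fixed for each of the 21 pairs, so that \<open>sat\<close>
    sees one atom per edge.\<close>
  have sym: "E y1 y0 = E y0 y1" "E y2 y0 = E y0 y2" "E y3 y0 = E y0 y3" "E y4 y0 = E y0 y4"
    "E y5 y0 = E y0 y5" "E y6 y0 = E y0 y6" "E y2 y1 = E y1 y2" "E y3 y1 = E y1 y3"
    "E y4 y1 = E y1 y4" "E y5 y1 = E y1 y5" "E y6 y1 = E y1 y6" "E y3 y2 = E y2 y3"
    "E y4 y2 = E y2 y4" "E y5 y2 = E y2 y5" "E y6 y2 = E y2 y6" "E y4 y3 = E y3 y4"
    "E y5 y3 = E y3 y5" "E y6 y3 = E y3 y6" "E y5 y4 = E y4 y5" "E y6 y4 = E y4 y6"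
    "E y6 y5 = E y5 y6"
    using E_commute by blast+
  note ear' = ear[unfolded sym]
  note y0 = wedge_in_7_cycle[OF assms(1) ys, unfolded sym]
  from c consider "c = y1" | "c = y2" | "c = y3" | "c = y4" | "c = y5" | "c = y6" by auto
  then show ?thesis
  proof cases
    case 1
    show ?thesis using y0 1 ear' wedge_in_7_cycle[OF assms(2)[unfolded 1] rot(1) st(1), unfolded sym]
      by sat
  next
    case 2
    show ?thesis using y0 2 ear' wedge_in_7_cycle[OF assms(2)[unfolded 2] rot(2) st(2), unfolded sym]
      by sat
  next
    case 3
    show ?thesis using y0 ear' wedge_in_7_cycle[OF assms(2)[unfolded 3] rot(3) st(3), unfolded sym]
      by sat
  next
    case 4
    show ?thesis using y0 ear' wedge_in_7_cycle[OF assms(2)[unfolded 4] rot(4) st(4), unfolded sym]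
      by sat
  next
    case 5
    show ?thesis using y0 5 ear' wedge_in_7_cycle[OF assms(2)[unfolded 5] rot(5) st(5), unfolded sym]
      by sat
  next
    case 6
    show ?thesis using y0 6 ear' wedge_in_7_cycle[OF assms(2)[unfolded 6] rot(6) st(6), unfolded sym]
      by sat
  qed
qed

text \<open>The wedges on either side force all of \<open>y0 y2\<close>, \<open>y0 y3\<close>,
  \<open>y0 y4\<close>, \<open>y0 y5\<close>, but every shape of a wedge at \<open>y0\<close> lacks
  \<open>y0 y3\<close> or \<open>y0 y4\<close>.\<close>

lemma wedge_consecutive_7:
  assumes ys: "cyclic_list bd [y0, y1, y2, y3, y4, y5, y6]" "B = set [y0, y1, y2, y3, y4, y5, y6]"
    and w: "wedge y0 p q" "wedge y1 p' q'" "wedge y6 p'' q''"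
  shows False
proof -
  have d: "distinct [y0, y1, y2, y3, y4, y5, y6]" using ys(1) unfolding cyclic_list_def by auto
  have "E y0 y5 \<and> E y0 y3" using wedge_pair_7[OF w(1,2) _ ys] d by auto
  moreover have "E y0 y2 \<and> E y0 y4" using wedge_pair_7[OF w(1,3) _ ys] d by auto
  ultimately show False using wedge_in_7_cycle[OF w(1) ys] by blast
qed

lemma wedge_length_cases:
  assumes "wedge c p q" "length bs \<le> 7"
  obtains (six) y1 y2 y3 y4 y5 where
      "cyclic_list bd [c, y1, y2, y3, y4, y5]" "B = set [c, y1, y2, y3, y4, y5]"
    | (seven) y1 y2 y3 y4 y5 y6 where
      "cyclic_list bd [c, y1, y2, y3, y4, y5, y6]" "B = set [c, y1, y2, y3, y4, y5, y6]"
proof -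
  obtain ys where ys: "cyclic_list bd (c # ys)" "B = set (c # ys)" "length bs = Suc (length ys)"
    using wedge_start[OF assms(1)] .
  have "length ys = 5 \<or> length ys = 6" using wedge_length[OF assms(1)] assms(2) ys(3) by auto
  then consider y1 y2 y3 y4 y5 where "ys = [y1, y2, y3, y4, y5]"
    | y1 y2 y3 y4 y5 y6 where "ys = [y1, y2, y3, y4, y5, y6]"
    by (auto simp: numeral_eq_Suc length_Suc_conv)
  then show thesis using ys six seven by cases metis+
qed

text \<open>Centres at distance 1 on \<open>B\<close> give the first case; at distance 2 the vertex
  between them is \<open>y\<close>.\<close>

lemma wedge_pair:
  assumes w: "wedge c p q" "wedge c' p' q'" "c \<noteq> c'" "length bs \<le> 7"
  shows "bd c c' \<or> E c c' \<and> (\<exists>y \<in> B. E c y \<and> E c' y)"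
  using w(1,4)
proof (cases rule: wedge_length_cases)
  case (six y1 y2 y3 y4 y5)
  then show ?thesis using wedge_unique_6[OF w(1,2)] w(3) by blast
next
  case (seven y1 y2 y3 y4 y5 y6)
  have b: "bd c y1" "bd y1 y2" "bd y5 y6" "bd y6 c"
    using seven(1) unfolding cyclic_list_def by auto
  then have e: "E c y1" "E y2 y1" "E c y6" "E y5 y6" using bd_E bd_sym by blast+
  show ?thesis
    using wedge_pair_7[OF w(1,2) w(3)[symmetric] seven] b(1) bd_sym[OF b(4)] e seven(2) by auto
qed

text \<open>Centres are pairwise at distance at most 2, so three of them on a 7-cycle would be
  consecutive.\<close>

lemma wedge_third:
  assumes w: "wedge c p q" "wedge c' p' q'" "wedge c'' p'' q''" "length bs \<le> 7"
  shows "c = c' \<or> c = c'' \<or> c' = c''"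
proof (rule ccontr)
  assume "\<not> ?thesis"
  then have n: "c' \<noteq> c" "c'' \<noteq> c" "c'' \<noteq> c'" by auto
  show False using w(1,4)
  proof (cases rule: wedge_length_cases)
    case (six y1 y2 y3 y4 y5)
    then show ?thesis using wedge_unique_6[OF w(1,2)] n(1) by blast
  next
    case (seven y1 y2 y3 y4 y5 y6)
    have d: "distinct [c, y1, y2, y3, y4, y5, y6]" using seven(1) unfolding cyclic_list_def by auto
    have r1: "cyclic_list bd [y1, y2, y3, y4, y5, y6, c]" "B = set [y1, y2, y3, y4, y5, y6, c]"
      and r2: "cyclic_list bd [y2, y3, y4, y5, y6, c, y1]" "B = set [y2, y3, y4, y5, y6, c, y1]"
      and r5: "cyclic_list bd [y5, y6, c, y1, y2, y3, y4]" "B = set [y5, y6, c, y1, y2, y3, y4]"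
      and r6: "cyclic_list bd [y6, c, y1, y2, y3, y4, y5]" "B = set [y6, c, y1, y2, y3, y4, y5]"
      using seven unfolding cyclic_list_def by auto
    have c': "c' \<in> {y1, y2, y5, y6}" using wedge_pair_7[OF w(1,2) n(1) seven] by auto
    have c'': "c'' \<in> {y1, y2, y5, y6}" using wedge_pair_7[OF w(1,3) n(2) seven] by auto
    from c' consider "c' = y1" | "c' = y2" | "c' = y5" | "c' = y6" by auto
    then show ?thesis
    proof cases
      case 1
      then have "c'' = y2 \<or> c'' = y6"
        using wedge_pair_7[OF w(2)[unfolded 1] w(3) _ r1] n c'' d by auto
      then show ?thesis
        using wedge_consecutive_7[OF r1, of p' q' p'' q'' p q] 1 w
          wedge_consecutive_7[OF seven w(1), of p' q' p'' q''] by auto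
    next
      case 2
      then have "c'' = y1"
        using wedge_pair_7[OF w(2)[unfolded 2] w(3) _ r2] n c'' d by auto
      then show ?thesis
        using wedge_consecutive_7[OF r1, of p'' q'' p' q' p q] 2 w by auto
    next
      case 3
      then have "c'' = y6"
        using wedge_pair_7[OF w(2)[unfolded 3] w(3) _ r5] n c'' d by auto
      then show ?thesis
        using wedge_consecutive_7[OF r6, of p'' q'' p q p' q'] 3 w by auto
    next
      case 4
      then have "c'' = y1 \<or> c'' = y5"
        using wedge_pair_7[OF w(2)[unfolded 4] w(3) _ r6] n c'' d by auto
      then show ?thesis
        using wedge_consecutive_7[OF r6, of p' q' p q p'' q''] 4 w
          wedge_consecutive_7[OF seven w(1), of p'' q'' p' q'] by auto
    qed
  qed
qed

text \<open>The edge \<open>c c'\<close> has either a single apex, or two of which one lies in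
  \<open>B\<close>.\<close>

lemma wedge_one_transition:
  assumes w: "wedge c p q" "wedge c' p' q'" "c \<noteq> c'" "length bs \<le> 7"
    and a: "a \<in> A" "a' \<in> A" "E a c" "E a c'" "E a' c" "E a' c'"
  shows "a = a'"
proof -
  have e: "E c a" "E c' a" "E c a'" "E c' a'" using a E_sym by blast+
  from wedge_pair[OF w] show ?thesis
  proof
    assume "bd c c'"
    then show ?thesis using bd_apex_unique e by blast
  next
    assume "E c c' \<and> (\<exists>y \<in> B. E c y \<and> E c' y)"
    then obtain y where "E c c'" "y \<in> B" "E c y" "E c' y" by blast
    then show ?thesis using common_neighbours_le_2[of c c' a a' y] e a(1,2) disjoint by blast
  qed
qed

section \<open>Triangles on the edges of \<open>A\<close> and the bound for a chordless
  \<open>A\<close>\<close>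

lemma A_proper: "A \<subset> V"
proof -
  have "bs \<noteq> []" using B_cycle unfolding cyclic_list_def by auto
  then have "hd bs \<in> B" by simp
  then have "hd bs \<in> V" "hd bs \<notin> A" using cover disjoint by auto
  then show ?thesis using cover by auto
qed

lemma AAB_triangle_exists: "\<exists>x \<in> A. \<exists>x' \<in> A. \<exists>b \<in> B. E x x' \<and> E x b \<and> E x' b"
proof -
  have "as \<noteq> []" using A_cycle unfolding cyclic_list_def by auto
  then have "A \<noteq> {}" by simp
  moreover have "A \<subset> V" by (rule A_proper)
  ultimately obtain u w where u: "u \<in> A" "w \<in> V - A" "E u w" using edge_out[of A] by auto
  then have "w \<in> B" using not_B_iff by auto
  then show ?thesis using mixed_triangle[OF u(1) _ u(3)] u(1) by auto
qed

text \<open>Without chords, an apex in \<open>A\<close> would give a triangle of boundary edges,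
  which is then the whole graph.\<close>

lemma B_apex:
  assumes chordless: "\<forall>x \<in> A. \<forall>x' \<in> A. E x x' \<longrightarrow> bd x x'"
    and x: "x \<in> A" "x' \<in> A" "bd x x'"
  obtains c p q where "E x c" "E x' c" "wedge c p q"
proof -
  obtain c where c: "E x c" "E x' c" using bd_apex[OF x(3)] by blast
  have "c \<in> B"
  proof (rule ccontr)
    assume "c \<notin> B"
    then have "c \<in> A" using not_B_iff E_in_V2 c(1) by blast
    then have "V = {x, x', c}" using bd_triangle[of x x' c] chordless x c E_sym by blast
    then show False using x \<open>c \<in> A\<close> A_proper by auto
  qed
  then have "\<exists>p q. wedge c p q"
    using wedge_exists[OF _ x(1,2) E_sym[OF c(1)] E_sym[OF c(2)] bd_E[OF x(3)]] chordless by simp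
  then show thesis using that c by blast
qed

text \<open>If \<open>B\<close> has at most 7 vertices, at most two apexes occur around
  \<open>A\<close>. They are not constant, so they change and change back, at two different vertices
  that both see the two centres, against \<open>wedge_one_transition\<close>.\<close>

lemma chordless_bound:
  assumes chordless: "\<forall>x \<in> A. \<forall>x' \<in> A. E x x' \<longrightarrow> bd x x'"
  shows "8 \<le> length bs"
proof (rule ccontr)
  assume "\<not> ?thesis"
  then have l: "length bs \<le> 7" by simp
  define k where "k = length as"
  have k: "3 \<le> k" and d: "distinct as" using A_cycle unfolding cyclic_list_def k_def by auto
  \<comment> \<open>Reading indices modulo the length lets the walk go on around
    \<open>A\<close>.\<close>
  define a where "a i = as ! (i mod k)" for i
  have lt: "i mod k < length as" for i
    using mod_less_divisor[of k i] k unfolding k_def by linarith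
  have aA: "a i \<in> A" for i unfolding a_def using lt by simp
  have a_eq: "a i = a j \<longleftrightarrow> i mod k = j mod k" for i j
    unfolding a_def using d lt by (simp add: nth_eq_iff_index_eq)
  have b: "bd (a i) (a (Suc i))" for i
    unfolding a_def k_def by (rule cyclic_list_nth_mod[OF A_cycle])
  have "\<forall>i. \<exists>c. E (a i) c \<and> E (a (Suc i)) c \<and> (\<exists>p q. wedge c p q)"
    using B_apex[OF chordless aA aA b] by metis
  then obtain c where c: "\<And>i. E (a i) (c i)" "\<And>i. E (a (Suc i)) (c i)"
    "\<And>i. \<exists>p q. wedge (c i) p q" by metis
  have period: "c (i + k) = c i" for i
  proof -
    have "a (i + k) = a i" "a (Suc (i + k)) = a (Suc i)"
      unfolding a_eq using mod_add_self2[of "Suc i" k] by auto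
    then show ?thesis using bd_apex_unique[OF b[of i]] c[of i] c[of "i + k"] by metis
  qed
  have "\<exists>i. c i \<noteq> c (Suc i)"
  proof (rule ccontr)
    assume "\<not> ?thesis"
    then have c0: "c i = c 0" for i by (induction i) auto
    \<comment> \<open>Otherwise all of \<open>A\<close> lies in the link of one vertex, and there
      each \<open>a i\<close> has its two cycle neighbours.\<close>
    show False
    proof (rule link_no_cycle[of "range a" "c 0"])
      show "E (c 0) x" if "x \<in> range a" for x using that c(1) c0 E_sym by (metis imageE)
      fix x assume "x \<in> range a"
      then obtain i where i: "x = a i" by blast
      \<comment> \<open>The predecessor of \<open>a i\<close> has index \<open>i + (k - 1)\<close>,
        which avoids truncated subtraction at 0.\<close>
      have "a (Suc (i + (k - 1))) = a i" unfolding a_eq using k by simp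
      then have "bd x (a (i + (k - 1)))" using b[of "i + (k - 1)"] i bd_sym by simp
      moreover have "a (Suc i) \<noteq> a (i + (k - 1))"
      proof
        assume "a (Suc i) = a (i + (k - 1))"
        then have "k dvd (i + (k - 1)) - Suc i" unfolding a_eq using k
          by (intro mod_eq_dvd_iff_nat[THEN iffD1]) simp_all
        then show False using k by (auto dest: dvd_imp_le)
      qed
      ultimately show "\<exists>y\<in>range a. \<exists>z\<in>range a. y \<noteq> z \<and> E x y \<and> E x z"
        using b[of i] i bd_E by blast
    qed simp
  qed
  then obtain i where i: "c i \<noteq> c (Suc i)" by blast
  \<comment> \<open>The next change of apex after the one at \<open>Suc i\<close>; periodicity
    bounds it by \<open>i + k\<close>.\<close>
  define j where "j = (LEAST j. Suc i < j \<and> c j \<noteq> c (Suc i))"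
  have ex: "Suc i < i + k \<and> c (i + k) \<noteq> c (Suc i)" using k period i by auto
  have j: "Suc i < j" "c j \<noteq> c (Suc i)" "j \<le> i + k"
    unfolding j_def using LeastI[of "\<lambda>j. Suc i < j \<and> c j \<noteq> c (Suc i)", OF ex]
      Least_le[of "\<lambda>j. Suc i < j \<and> c j \<noteq> c (Suc i)", OF ex] by auto
  obtain m where m: "j = Suc m" using j(1) by (cases j) auto
  have cm: "c m = c (Suc i)"
  proof (cases "m = Suc i")
    case False
    then show ?thesis
      using not_less_Least[of m "\<lambda>j. Suc i < j \<and> c j \<noteq> c (Suc i)"] j(1) m
      unfolding j_def[symmetric] by auto
  qed simp
  have cj: "c j = c i" using wedge_third[OF _ _ _ l] c(3) i j(2) by metis
  \<comment> \<open>\<open>a (Suc i)\<close> sees \<open>c i\<close> and \<open>c (Suc i)\<close>;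
    \<open>a j\<close> sees \<open>c m\<close> and \<open>c j\<close>, which are the same two
    centres.\<close>
  have "a (Suc i) = a j"
  proof -
    obtain p q p' q' where w: "wedge (c i) p q" "wedge (c (Suc i)) p' q'" using c(3) by metis
    show ?thesis
      using wedge_one_transition[OF w i l aA aA] c(1)[of "Suc i"] c(2)[of i] c(1)[of j] c(2)[of m]
      unfolding cm cj m by (metis cj m)
  qed
  then have "k dvd j - Suc i" unfolding a_eq using j(1) by (intro mod_eq_dvd_iff_nat[THEN iffD1]) simp_all
  then show False using j(1,3) k by (auto dest!: dvd_imp_le)
qed

section \<open>A cycle \<open>A\<close> of length 4 or 5\<close>

lemma chordless_4_cycle:
  assumes xs: "cyclic_list bd [a0, a1, a2, a3]" "A = set [a0, a1, a2, a3]"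
  shows "\<not> E a0 a2"
proof
  assume e: "E a0 a2"
  have b: "bd a0 a1" "bd a1 a2" "bd a2 a3" "bd a3 a0" and d: "distinct [a0, a1, a2, a3]"
    using xs(1) unfolding cyclic_list_def by auto
  note E = b[THEN bd_E] b[THEN bd_E, THEN E_sym] e e[THEN E_sym]
  obtain x x' c where c: "x \<in> A" "x' \<in> A" "c \<in> B" "E x x'" "E x c" "E x' c"
    using AAB_triangle_exists by blast
  have n: "c \<noteq> a0" "c \<noteq> a1" "c \<noteq> a2" "c \<noteq> a3" using c(3) xs(2) disjoint by auto
  \<comment> \<open>The boundary edges have their only apex in \<open>A\<close> and the chord has
    both of its apexes there, so no edge of \<open>A\<close> is left for \<open>c\<close>.\<close>
  have apex: "\<not> (E a0 c \<and> E a1 c)" "\<not> (E a1 c \<and> E a2 c)" "\<not> (E a2 c \<and> E a3 c)"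
    "\<not> (E a3 c \<and> E a0 c)" "\<not> (E a0 c \<and> E a2 c)"
    using bd_apex_unique[OF b(1), of a2 c] bd_apex_unique[OF b(2), of a0 c]
      bd_apex_unique[OF b(3), of a0 c] bd_apex_unique[OF b(4), of a2 c]
      common_neighbours_le_2[OF e, of a1 a3 c] E n d by auto
  have ear: "\<not> E a1 a3" "\<not> E a3 a1" using ear_isolated[OF b(1,2) e, of a3] d E_sym by auto
  show False using c apex ear E_neq[OF c(4)] xs(2) by auto
qed

text \<open>Two chords at \<open>a1\<close> triangulate the pentagon, so again no edge of
  \<open>A\<close> could have an apex in \<open>B\<close>.\<close>

lemma chord_5_cycle_unique:
  assumes xs: "cyclic_list bd [a0, a1, a2, a3, a4]" "A = set [a0, a1, a2, a3, a4]"
    and e: "E a1 a4"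
  shows "\<not> E a1 a3"
proof
  assume f: "E a1 a3"
  have b: "bd a0 a1" "bd a1 a2" "bd a2 a3" "bd a3 a4" "bd a4 a0"
    and d: "distinct [a0, a1, a2, a3, a4]"
    using xs(1) unfolding cyclic_list_def by auto
  note E = b[THEN bd_E] b[THEN bd_E, THEN E_sym] e e[THEN E_sym] f f[THEN E_sym]
  obtain x x' c where c: "x \<in> A" "x' \<in> A" "c \<in> B" "E x x'" "E x c" "E x' c"
    using AAB_triangle_exists by blast
  have n: "c \<noteq> a0" "c \<noteq> a1" "c \<noteq> a2" "c \<noteq> a3" "c \<noteq> a4" using c(3) xs(2) disjoint by auto
  have apex: "\<not> (E a0 c \<and> E a1 c)" "\<not> (E a1 c \<and> E a2 c)" "\<not> (E a2 c \<and> E a3 c)"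
    "\<not> (E a3 c \<and> E a4 c)" "\<not> (E a4 c \<and> E a0 c)" "\<not> (E a1 c \<and> E a4 c)" "\<not> (E a1 c \<and> E a3 c)"
    using bd_apex_unique[OF b(1), of a4 c] bd_apex_unique[OF b(2), of a3 c]
      bd_apex_unique[OF b(3), of a1 c] bd_apex_unique[OF b(4), of a1 c]
      bd_apex_unique[OF b(5), of a1 c] common_neighbours_le_2[OF e, of a0 a3 c]
      common_neighbours_le_2[OF f, of a2 a4 c] E n d by auto
  have "\<not> E a0 a2" "\<not> E a0 a3" "\<not> E a2 a4"
    using ear_isolated[OF b(5,1), of a2] ear_isolated[OF b(5,1), of a3]
      ear_isolated[OF b(2,3), of a4] d E by auto
  then have ear: "\<not> E a0 a2" "\<not> E a0 a3" "\<not> E a2 a4" "\<not> E a2 a0" "\<not> E a3 a0" "\<not> E a4 a2"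
    using E_sym by blast+
  show False using c apex ear E_neq[OF c(4)] xs(2) by auto
qed

text \<open>\<open>x' c'\<close> has a second apex \<open>z\<close> besides \<open>x''\<close>. It
  is not \<open>x\<close>, since \<open>c\<close> is the only apex of \<open>x x'\<close>, so it
  lies in \<open>B\<close>; a boundary edge \<open>z c'\<close> would form a ladder with
  \<open>x' x''\<close>.\<close>

lemma transition_chord:
  assumes x: "x' \<in> A" "x'' \<in> A" "bd x x'" "bd x' x''"
    and only: "\<And>z. z \<in> A \<Longrightarrow> E x' z \<Longrightarrow> z = x \<or> z = x''"
    and c: "E x c" "E x' c" "E x' c'" "E x'' c'" "c \<noteq> c'" "c' \<in> B"
  obtains z where "z \<in> B" "E c' z" "\<not> bd c' z"
proof -
  obtain w w' where w: "w \<noteq> w'" "E x' w" "E c' w" "E x' w'" "E c' w'"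
    using not_bd_common_neighbours[OF c(3) mixed_not_bd(1)[OF x(1) c(6)]] .
  obtain z where z: "z \<noteq> x''" "E x' z" "E c' z" using w by metis
  have "z \<noteq> x"
  proof
    assume "z = x"
    then show False using bd_apex_unique[OF x(3) c(1,2), of c'] z c E_sym by blast
  qed
  then have zB: "z \<in> B" using only z not_B_iff E_in_V2 by metis
  have "\<not> bd z c'" using ladder[OF x(1,2) zB c(6) x(4) z(2) c(4)] .
  then show thesis using that zB z bd_sym by blast
qed

text \<open>The chord \<open>d0 d3\<close> cuts off the ear \<open>e\<close> and has its other apex
  \<open>g\<close> in \<open>B\<close>. The apexes of the three remaining edges are \<open>g\<close>
  or wedge centres. If \<open>B\<close> has 6 vertices there is one centre \<open>c\<close>, and
  \<open>g\<close> must both have and lack a chord of \<open>B\<close>.\<close>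

lemma ear_5_cycle_bound:
  assumes xs: "cyclic_list bd [e, d0, d1, d2, d3]" "A = set [e, d0, d1, d2, d3]"
    and ch: "E d0 d3"
  shows "7 \<le> length bs"
proof (rule ccontr)
  assume "\<not> ?thesis"
  then have l: "length bs \<le> 7" "length bs \<noteq> 7" by simp_all
  have b: "bd e d0" "bd d0 d1" "bd d1 d2" "bd d2 d3" "bd d3 e" and d: "distinct [e, d0, d1, d2, d3]"
    using xs(1) unfolding cyclic_list_def by auto
  note E = b[THEN bd_E] b[THEN bd_E, THEN E_sym] ch ch[THEN E_sym]
  have rev: "cyclic_list bd [e, d3, d2, d1, d0]" "A = set [e, d3, d2, d1, d0]"
    using xs bd_sym unfolding cyclic_list_def by auto
  have "\<not> E d0 d2" "\<not> E d3 d1" "\<not> E e d1" "\<not> E e d2"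
    using chord_5_cycle_unique[OF xs ch] chord_5_cycle_unique[OF rev E_sym[OF ch]]
      ear_isolated[OF b(5,1) E_sym[OF ch]] d by auto
  then have nE: "\<not> E d0 d2" "\<not> E d3 d1" "\<not> E e d1" "\<not> E e d2" "\<not> E d2 d0" "\<not> E d1 d3"
    "\<not> E d1 e" "\<not> E d2 e" using E_sym by blast+
  have eB: "\<not> E e y" if "y \<in> B" for y
    using ear_isolated[OF b(5,1) E_sym[OF ch], of y] that xs(2) disjoint by auto
  have inB: "y \<in> B" if "E x y" "y \<notin> A" for x y using that not_B_iff E_in_V2 by blast
  have apexB: "y \<in> B" if "E d0 y \<and> E d1 y \<or> E d1 y \<and> E d2 y \<or> E d2 y \<and> E d3 y" for y
  proof -
    have "y \<notin> A" using that nE E_irrefl xs(2) by auto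
    then show ?thesis using that inB by blast
  qed
  obtain c0 where c0: "E d0 c0" "E d1 c0" "c0 \<in> B" using bd_apex[OF b(2)] apexB by blast
  obtain c1 where c1: "E d1 c1" "E d2 c1" "c1 \<in> B" using bd_apex[OF b(3)] apexB by blast
  obtain c2 where c2: "E d2 c2" "E d3 c2" "c2 \<in> B" using bd_apex[OF b(4)] apexB by blast
  have "\<not> bd d0 d3" using bd_neighbours_le_2[of d0 e d1 d3] b bd_sym d by auto
  then obtain w w' where w: "w \<noteq> w'" "E d0 w" "E d3 w" "E d0 w'" "E d3 w'"
    using not_bd_common_neighbours[OF ch] by blast
  obtain g where g: "g \<noteq> e" "E d0 g" "E d3 g" using w by metis
  have gB: "g \<in> B" by (rule inB[OF g(2)]) (use g nE E_irrefl xs(2) in auto)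
  have g_unique: "y = g" if "y \<in> B" "E d0 y" "E d3 y" for y
    using common_neighbours_le_2[OF ch, of e g y] that g E xs(2) disjoint by auto
  \<comment> \<open>Only \<open>g\<close> sees both ends of the chord, so every other vertex of
    \<open>B\<close> satisfies the condition of \<open>wedge_exists\<close>.\<close>
  have rim: "bd u u'" if "y \<in> B" "y \<noteq> g" "u \<in> A" "u' \<in> A" "E y u" "E y u'" "E u u'" for y u u'
    using that g_unique[of y] E_sym[of y] eB[of y] b bd_sym nE E_irrefl xs(2) by auto
  have m: "d0 \<in> A" "d1 \<in> A" "d2 \<in> A" "d3 \<in> A" using xs(2) by auto
  have w0: "\<exists>p q. wedge c0 p q" if "c0 \<noteq> g"
    using wedge_exists[OF c0(3) m(1,2) _ _ E(2)] rim[OF c0(3) that] c0 E_sym by blast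
  have w1: "\<exists>p q. wedge c1 p q" if "c1 \<noteq> g"
    using wedge_exists[OF c1(3) m(2,3) _ _ E(3)] rim[OF c1(3) that] c1 E_sym by blast
  have w2: "\<exists>p q. wedge c2 p q" if "c2 \<noteq> g"
    using wedge_exists[OF c2(3) m(3,4) _ _ E(4)] rim[OF c2(3) that] c2 E_sym by blast
  have not_g: "\<not> (c0 = g \<and> c1 = g \<and> c2 = g)"
  proof
    assume q: "c0 = g \<and> c1 = g \<and> c2 = g"
    show False
    proof (rule link_no_cycle[of "{d0, d1, d2, d3}" g])
      show "E g x" if "x \<in> {d0, d1, d2, d3}" for x using that q c0 c1 c2 E_sym by blast
      show "\<exists>y\<in>{d0, d1, d2, d3}. \<exists>z\<in>{d0, d1, d2, d3}. y \<noteq> z \<and> E x y \<and> E x z"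
        if "x \<in> {d0, d1, d2, d3}" for x
        using that d E by auto
    qed simp
  qed
  then obtain c p q where c: "c \<noteq> g" "wedge c p q" using w0 w1 w2 by metis
  obtain y1 y2 y3 y4 y5 where
    ys: "cyclic_list bd [c, y1, y2, y3, y4, y5]" "B = set [c, y1, y2, y3, y4, y5]"
    using c(2) l(1)
  proof (cases rule: wedge_length_cases)
    case (seven y1 y2 y3 y4 y5 y6)
    have "length bs = 7"
      using distinct_card[of bs] distinct_card[of "[c, y1, y2, y3, y4, y5, y6]"] seven B_cycle
      unfolding cyclic_list_def by simp
    then show ?thesis using l by simp
  qed (use that in blast)
  have c_unique: "c' = c" if "wedge c' p' q'" for c' p' q'
    using wedge_unique_6[OF c(2) that ys] .
  have ci: "c0 = c \<or> c0 = g" "c1 = c \<or> c1 = g" "c2 = c \<or> c2 = g"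
    using w0 w1 w2 c_unique by blast+
  have not_c: "\<not> (c0 = c \<and> c2 = c)" using g_unique[of c] c0 c2 c(1) by auto
  have only1: "z = d0 \<or> z = d2" if "z \<in> A" "E d1 z" for z using that nE E_irrefl xs(2) by auto
  have only2: "z = d1 \<or> z = d3" if "z \<in> A" "E d2 z" for z using that nE E_irrefl xs(2) by auto
  \<comment> \<open>Along \<open>c0\<close>, \<open>c1\<close>, \<open>c2\<close> the apex switches
    between \<open>c\<close> and \<open>g\<close>; \<open>transition_chord\<close>, read towards
    \<open>g\<close>, gives the chord.\<close>
  have "\<exists>z \<in> B. E g z \<and> \<not> bd g z"
  proof (cases "c0 = c1")
    case True
    then consider "c1 = c" "c2 = g" | "c1 = g" "c2 = c" using ci not_g not_c by metis
    then show ?thesis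
    proof cases
      case 1
      then show ?thesis
        using transition_chord[OF m(3,4) b(3,4) only2 c1(1,2), of g] c2 c(1) gB by metis
    next
      case 2
      then show ?thesis
        using transition_chord[OF m(3,2) bd_sym[OF b(4)] bd_sym[OF b(3)] _ c2(2,1), of g]
          only2 c1 c(1) gB by metis
    qed
  next
    case False
    then consider "c0 = c" "c1 = g" | "c0 = g" "c1 = c" using ci by metis
    then show ?thesis
    proof cases
      case 1
      then show ?thesis
        using transition_chord[OF m(2,3) b(2,3) only1 c0(1,2), of g] c1 c(1) gB by metis
    next
      case 2
      then show ?thesis
        using transition_chord[OF m(2,1) bd_sym[OF b(3)] bd_sym[OF b(2)] _ c1(2,1), of g]
          only1 c0 c(1) gB by metis
    qed
  qed
  then obtain z where z: "z \<in> B" "E g z" "\<not> bd g z" by blast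
  \<comment> \<open>Around \<open>d0 d1 d2 d3\<close> the apexes are \<open>c0\<close>,
    \<open>c1\<close>, \<open>c2\<close>, \<open>g\<close>. Both \<open>c\<close> and
    \<open>g\<close> occur, so there are at least two switches, each at a vertex seeing
    both.\<close>
  have "\<exists>x \<in> A. \<exists>x' \<in> A. x \<noteq> x' \<and> E c x \<and> E c x' \<and> E g x \<and> E g x'"
  proof -
    have "c0 = c \<or> c2 = c \<or> c0 = g \<and> c1 = c \<and> c2 = g" using ci not_g by metis
    then consider "c0 = c" "c1 = g" "c2 = g" | "c0 = c" "c1 = c" "c2 = g"
      | "c2 = c" "c1 = g" "c0 = g" | "c2 = c" "c1 = c" "c0 = g" | "c0 = g" "c1 = c" "c2 = g"
      using ci not_c by metis
    then show ?thesis
    proof cases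
      case 1
      then show ?thesis using c0 c1 g m d E_sym by (intro bexI[of _ d0] bexI[of _ d1]) auto
    next
      case 2
      then show ?thesis using c0 c1 c2 g m d E_sym by (intro bexI[of _ d0] bexI[of _ d2]) auto
    next
      case 3
      then show ?thesis using c1 c2 g m d E_sym by (intro bexI[of _ d2] bexI[of _ d3]) auto
    next
      case 4
      then show ?thesis using c0 c1 c2 g m d E_sym by (intro bexI[of _ d1] bexI[of _ d3]) auto
    next
      case 5
      then show ?thesis using c0 c1 c2 g m d E_sym by (intro bexI[of _ d1] bexI[of _ d2]) auto
    qed
  qed
  then obtain x x' where x: "x \<in> A" "x' \<in> A" "x \<noteq> x'" "E c x" "E c x'" "E g x" "E g x'" by blast
  have yb: "bd c y1" "bd y1 y2" "bd y2 y3" "bd y3 y4" "bd y4 y5" "bd y5 c"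
    and yd: "distinct [c, y1, y2, y3, y4, y5]"
    using ys(1) unfolding cyclic_list_def by auto
  note yE = yb[THEN bd_E] yb[THEN bd_E, THEN E_sym]
  have W: "E c y2" "E c y4" "\<not> E c y3" using wedge_in_6_cycle[OF c(2) ys] by auto
  \<comment> \<open>With two common neighbours in \<open>A\<close>, the pair \<open>c\<close>,
    \<open>g\<close> is no boundary edge and no chord with an apex in \<open>B\<close>. So
    \<open>g\<close> is opposite \<open>c\<close>, and no chord ends there.\<close>
  have "g \<noteq> y1" "g \<noteq> y5"
    using bd_apex_unique[of c g x x'] x yb bd_sym by auto
  moreover have "g \<noteq> y2" "g \<noteq> y4"
    using common_neighbours_le_2[of c g x x' y1] common_neighbours_le_2[of c g x x' y5]
      x yE W ys(2) disjoint by auto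
  ultimately have g3: "g = y3" using gB ys(2) c(1) by auto
  have "\<not> E y1 y3" "\<not> E y5 y3"
    using ear_isolated[OF yb(1,2) W(1), of y3] ear_isolated[OF yb(5,6) E_sym[OF W(2)], of y3] yd
    by auto
  then show False
    using z g3 ys(2) W(3) yb bd_sym E_sym E_irrefl by auto
qed

text \<open>A chordless \<open>A\<close> gives 4 + 8. Otherwise a counterexample has
  \<open>A\<close> of length 4, which admits no chord, or 5, which gives 5 + 7.\<close>

lemma two_cycles_bound:
  assumes le: "length as \<le> length bs"
  shows "12 \<le> length as + length bs"
proof (rule ccontr)
  assume small: "\<not> ?thesis"
  have l: "4 \<le> length as" using bd_cycle_length[OF A_cycle A_proper] .
  have n: "\<not> (\<forall>x \<in> A. \<forall>x' \<in> A. E x x' \<longrightarrow> bd x x')" using chordless_bound l small by auto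
  then obtain x x' where x: "x \<in> A" "x' \<in> A" "E x x'" "\<not> bd x x'" by blast
  obtain ys where ys: "cyclic_list bd (x # ys)" "set (x # ys) = A" "length (x # ys) = length as"
    using cyclic_list_start[OF A_cycle x(1)] .
  have x': "x' \<in> set (x # ys)" using x(2) ys(2) by simp
  have "length ys = 3 \<or> length ys = 4" using ys(3) l le small by auto
  then consider y1 y2 y3 where "ys = [y1, y2, y3]" | y1 y2 y3 y4 where "ys = [y1, y2, y3, y4]"
    by (auto simp: numeral_eq_Suc length_Suc_conv)
  then show False
  proof cases
    case 1
    then have b: "bd x y1" "bd y3 x" using ys(1) unfolding cyclic_list_def by auto
    have "x' = y2" using x(3,4) x' 1 b bd_sym E_irrefl by auto
    then show ?thesis using chordless_4_cycle[of x y1 y2 y3] ys 1 x(3) by auto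
  next
    case 2
    then have b: "bd x y1" "bd y1 y2" "bd y2 y3" "bd y3 y4" "bd y4 x"
      and d: "distinct [x, y1, y2, y3, y4]"
      using ys(1) unfolding cyclic_list_def by auto
    have "x' = y2 \<or> x' = y3" using x(3,4) x' 2 b bd_sym E_irrefl by auto
    then have "7 \<le> length bs"
    proof
      assume q: "x' = y2"
      have "cyclic_list bd [y1, y2, y3, y4, x]" "A = set [y1, y2, y3, y4, x]"
        using b d 2 ys(2) unfolding cyclic_list_def by auto
      then show ?thesis using ear_5_cycle_bound x(3) q E_sym by blast
    next
      assume q: "x' = y3"
      have "cyclic_list bd [y4, x, y1, y2, y3]" "A = set [y4, x, y1, y2, y3]"
        using b d 2 ys(2) unfolding cyclic_list_def by auto
      then show ?thesis using ear_5_cycle_bound x(3) q E_sym by blast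
    qed
    then show ?thesis using ys(3) 2 small by simp
  qed
qed

end

section \<open>The lower bound for any number of boundary cycles\<close>

context locally_linear_graph
begin

theorem nonhamiltonian_bound:
  assumes nonham: "\<nexists>xs. cyclic_list E xs \<and> set xs = V"
  shows "12 \<le> card V"
proof -
  have not_all: "set xs \<noteq> V" if "cyclic_list bd xs" for xs
    using nonham cyclic_list_mono[OF that, of E] bd_E by blast
  have len: "4 \<le> card (set xs)" if "cyclic_list bd xs" "set xs \<subseteq> V" for xs
    using bd_cycle_length[of xs] not_all[OF that(1)] that distinct_card[of xs]
    unfolding cyclic_list_def by auto
  \<comment> \<open>A boundary path starting outside a boundary cycle never enters it, by
    \<open>bd_cycle_closed\<close>.\<close>
  have disj: "set xs \<inter> set ys = {}"
    if xs: "cyclic_list bd xs" and ys: "cyclic_list bd ys" "v \<in> set ys" "v \<notin> set xs" for xs ys v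
  proof -
    have outside: "set zs \<subseteq> - set xs" if "successively bd (v # zs)" for zs
      using that ys(3)
    proof (induction zs arbitrary: v)
      case (Cons z zs)
      then have "z \<notin> set xs" using bd_cycle_closed[OF xs, of z v] bd_sym by auto
      then show ?case using Cons by auto
    qed simp
    obtain zs where zs: "cyclic_list bd (v # zs)" "set (v # zs) = set ys"
      using cyclic_list_start[OF ys(1,2)] by metis
    have "set zs \<subseteq> - set xs" using outside zs(1) unfolding cyclic_list_def by blast
    then show ?thesis using zs(2) ys(3) by auto
  qed
  obtain v where "v \<in> V" using V_nonempty by blast
  then obtain as where A: "cyclic_list bd as" "set as \<subseteq> V" using bd_cycle_exists by metis
  then obtain w where w: "w \<in> V" "w \<notin> set as" using not_all by blast
  then obtain bs where B: "cyclic_list bd bs" "w \<in> set bs" "set bs \<subseteq> V"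
    using bd_cycle_exists by metis
  have AB: "set as \<inter> set bs = {}" using disj[OF A(1) B(1,2) w(2)] .
  show ?thesis
  proof (cases "set as \<union> set bs = V")
    case True
    have lf: "ladder_free (set as) (set bs)"
      using ladder_hamiltonian[OF A(1) B(1) AB] nonham True by metis
    then have lf': "ladder_free (set bs) (set as)" unfolding ladder_free_def using E_sym by blast
    \<comment> \<open>Both orders are needed because the shorter cycle has to play the role of
      \<open>A\<close>.\<close>
    have "two_boundary_cycles V E as bs" "two_boundary_cycles V E bs as"
      using A(1) B(1) AB True lf lf'
      by (unfold_locales; auto)+
    then have "12 \<le> length as + length bs"
      using two_boundary_cycles.two_cycles_bound[of V E as bs]
        two_boundary_cycles.two_cycles_bound[of V E bs as] by linarith
    moreover have "card V = length as + length bs"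
      using True AB A(1) B(1) unfolding cyclic_list_def
      by (metis List.finite_set card_Un_disjoint distinct_card)
    ultimately show ?thesis by simp
  next
    case False
    then obtain u where u: "u \<in> V" "u \<notin> set as" "u \<notin> set bs" using A(2) B(3) by blast
    obtain cs where C: "cyclic_list bd cs" "u \<in> set cs" "set cs \<subseteq> V"
      using bd_cycle_exists[OF u(1)] .
    have "(set as \<union> set bs) \<inter> set cs = {}"
      using disj[OF A(1) C(1,2) u(2)] disj[OF B(1) C(1,2) u(3)] by blast
    then have "card (set as \<union> set bs \<union> set cs) = card (set as) + card (set bs) + card (set cs)"
      using AB by (simp add: card_Un_disjoint)
    moreover have "card (set as \<union> set bs \<union> set cs) \<le> card V"
      using A(2) B(3) C(3) finite_V by (intro card_mono) auto
    ultimately show ?thesis using len[OF A] len[OF B(1,3)] len[OF C(1,3)] by linarith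
  qed
qed

end

section \<open>From digraphs to locally linear graphs\<close>

text \<open>Arcs of a pair digraph are pairs of vertices, so a vertex list zipped with its tail is
  the walk along it.\<close>

lemma pcas_zip: "pcas (hd (xs @ [w])) (zip xs (tl (xs @ [w]))) w"
proof (induction xs)
  case (Cons x xs)
  then show ?case by (cases xs) auto
qed simp

lemma pawalk_verts_zip: "pawalk_verts u (zip xs (tl (xs @ [w]))) = (if xs = [] then [u] else xs @ [w])"
proof (induction xs arbitrary: u)
  case (Cons x xs)
  then show ?case by (cases xs) auto
qed simp

lemma hamiltonianI:
  assumes "pair_graph G" and xs: "cyclic_list (\<lambda>u v. (u, v) \<in> parcs G) xs" "set xs = pverts G"
  shows "hamiltonian (with_proj G)"
proof -
  interpret pair_graph G by fact
  have l: "3 \<le> length xs" and d: "distinct xs" and s: "successively (\<lambda>u v. (u, v) \<in> parcs G) xs"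
    and c: "(last xs, hd xs) \<in> parcs G"
    using xs(1) unfolding cyclic_list_def by auto
  have ne: "xs \<noteq> []" using l by auto
  define p where "p = zip xs (tl (xs @ [hd xs]))"
  have len: "length (tl (xs @ [hd xs])) = length xs" by simp
  have "set p \<subseteq> parcs G"
  proof
    fix e assume "e \<in> set p"
    then obtain i where i: "i < length xs" "e = (xs ! i, tl (xs @ [hd xs]) ! i)"
      unfolding p_def by (auto simp: set_zip)
    show "e \<in> parcs G"
    proof (cases "Suc i < length xs")
      case True
      then show ?thesis using i s by (auto simp: successively_conv_nth nth_tl nth_append)
    next
      case False
      then have "i = length xs - 1" using i by simp
      then show ?thesis using i ne c False by (auto simp: nth_tl nth_append last_conv_nth)
    qed
  qed
  moreover have "pcas (hd xs) p (hd xs)" using pcas_zip[of xs "hd xs"] ne unfolding p_def by simp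
  moreover have "hd xs \<in> pverts G" using ne xs(2) hd_in_set by blast
  ultimately have "awalk (hd xs) p (hd xs)" unfolding awalk_def by simp
  moreover have "pawalk_verts (hd xs) p = xs @ [hd xs]"
    unfolding p_def using pawalk_verts_zip[of "hd xs" xs "hd xs"] ne by simp
  then have "distinct (tl (pawalk_verts (hd xs) p))" using d ne by (cases xs) auto
  moreover have "length p = length xs" unfolding p_def by simp
  moreover have "fst ` set p = set xs" unfolding p_def using len by (metis list.set_map map_fst_zip)
  ultimately show ?thesis
    unfolding hamiltonian_def using l ne xs(2)
    by (intro exI[of _ p]) (auto simp: cycle_def)
qed

lemma neighbourhood_with_proj: "neighbourhood (with_proj G) v = {u. (v, u) \<in> parcs G}"
  unfolding neighbourhood_def by simp

lemma arcs_ends_induced: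
  "arcs_ends (with_proj G \<restriction> S) = {e \<in> parcs G. fst e \<in> S \<and> snd e \<in> S}"
  by (auto simp: arcs_ends_conv)

text \<open>A set that no arc leaves contains everything reachable from it, and passing to
  \<open>mk_symmetric\<close> does not change reachability in a symmetric graph.\<close>

lemma connected_edge_out:
  assumes "pair_graph G" "Digraph_Component.connected (with_proj G)"
    and S: "S \<subseteq> pverts G" "S \<noteq> {}" "S \<noteq> pverts G"
  shows "\<exists>u \<in> S. \<exists>w \<in> pverts G - S. (u, w) \<in> parcs G"
proof (rule ccontr)
  assume n: "\<not> ?thesis"
  interpret pair_graph G by fact
  obtain u v where uv: "u \<in> S" "v \<in> pverts G" "v \<notin> S" using S by blast
  then have "u \<rightarrow>\<^sup>*\<^bsub>with_proj (mk_symmetric (with_proj G))\<^esub> v"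
    using assms(2) S(1) unfolding Digraph_Component.connected_def strongly_connected_def by auto
  then have "u \<rightarrow>\<^sup>*\<^bsub>with_proj G\<^esub> v" using reachable_mk_symmetric_eq sym_arcs by blast
  then have "v \<in> S" using uv(1)
  proof (induction rule: reachable_induct)
    case (step x y)
    then have "(x, y) \<in> parcs G" by simp
    then show ?case using n step in_arcsD2 by blast
  qed simp
  then show False using uv by blast
qed

lemma locally_linear_graph_of_digraph:
  assumes G: "pair_graph G" "Digraph_Component.connected (with_proj G)" "locally_linear (with_proj G)"
    and card: "3 \<le> card (pverts G)"
  shows "locally_linear_graph (pverts G) (\<lambda>u v. (u, v) \<in> parcs G)"
proof -
  interpret pair_graph G by fact
  have link: "\<exists>xs. xs \<noteq> [] \<and> distinct xs \<and> set xs = {u. (v, u) \<in> parcs G} \<and>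
      (\<forall>i < length xs. \<forall>j < length xs. (xs ! i, xs ! j) \<in> parcs G \<longleftrightarrow> j = Suc i \<or> i = Suc j)"
    if v: "v \<in> pverts G" for v
  proof -
    let ?N = "{u. (v, u) \<in> parcs G}"
    have "path_graph (with_proj G \<restriction> ?N)"
      using G(3) v unfolding locally_linear_def neighbourhood_with_proj by auto
    then obtain xs where xs: "xs \<noteq> []" "distinct xs" "?N = set xs"
      "{e \<in> parcs G. fst e \<in> ?N \<and> snd e \<in> ?N} = {(xs ! i, xs ! j) | i j.
         i < length xs \<and> j < length xs \<and> (j = Suc i \<or> i = Suc j)}"
      unfolding path_graph_def arcs_ends_induced induce_subgraph_verts by blast
    have "(xs ! i, xs ! j) \<in> parcs G \<longleftrightarrow> j = Suc i \<or> i = Suc j"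
      if ij: "i < length xs" "j < length xs" for i j
    proof -
      have "(xs ! i, xs ! j) \<in> parcs G \<longleftrightarrow> (xs ! i, xs ! j) \<in> {e \<in> parcs G. fst e \<in> ?N \<and> snd e \<in> ?N}"
        unfolding xs(3) using ij by simp
      also have "\<dots> \<longleftrightarrow> j = Suc i \<or> i = Suc j"
        unfolding xs(4) using ij xs(2) by (auto simp: nth_eq_iff_index_eq)
      finally show ?thesis .
    qed
    then show ?thesis using xs by auto
  qed
  \<comment> \<open>If \<open>u\<close> is the only neighbour of \<open>v\<close>, then
    \<open>v\<close> is isolated in the link of \<open>u\<close>, so that path is \<open>v\<close>
    alone and \<open>{u, v}\<close> is a component, against the three vertices.\<close>
  have two: "2 \<le> length xs"
    if v: "v \<in> pverts G" and xs: "xs \<noteq> []" "set xs = {u. (v, u) \<in> parcs G}" for v xs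
  proof (rule ccontr)
    assume "\<not> ?thesis"
    then obtain u where "xs = [u]" using xs(1) by (cases xs; cases "tl xs") auto
    then have u: "\<And>w. (v, w) \<in> parcs G \<longleftrightarrow> w = u" using xs(2) by auto
    have vu: "(v, u) \<in> parcs G" using u by blast
    then have uv: "(u, v) \<in> parcs G" and "u \<in> pverts G" using arcs_symmetric in_arcsD2 by blast+
    obtain ys where ys: "distinct ys" "set ys = {w. (u, w) \<in> parcs G}"
      "\<And>i j. \<lbrakk>i < length ys; j < length ys\<rbrakk> \<Longrightarrow> (ys ! i, ys ! j) \<in> parcs G \<longleftrightarrow> j = Suc i \<or> i = Suc j"
      using link[OF \<open>u \<in> pverts G\<close>] by metis
    have no: "(v, w) \<notin> parcs G" if "(u, w) \<in> parcs G" for w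
      using that u[of w] no_loops'[of u w] by simp
    obtain i where i: "i < length ys" "v = ys ! i" using ys(2) uv by (metis in_set_conv_nth mem_Collect_eq)
    have nth: "(u, ys ! j) \<in> parcs G" if "j < length ys" for j using ys(2) that nth_mem by blast
    have "length ys = 1"
    proof (rule ccontr)
      assume "length ys \<noteq> 1"
      then consider "Suc i < length ys" | j where "i = Suc j" using i by (cases i) auto
      then show False
      proof cases
        case 1
        then show ?thesis using ys(3)[of i "Suc i"] i no[OF nth] by auto
      next
        case 2
        then show ?thesis using ys(3)[of i j] i no[OF nth, of j] by auto
      qed
    qed
    then have "set ys = {v}" using i by (cases ys) auto
    then have "(u, w) \<in> parcs G \<longleftrightarrow> w = v" for w using ys(2) by auto
    then have "\<not> (\<exists>x \<in> {u, v}. \<exists>w \<in> pverts G - {u, v}. (x, w) \<in> parcs G)" using u by auto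
    then have "{u, v} = pverts G"
      using connected_edge_out[OF G(1,2), of "{u, v}"] v \<open>u \<in> pverts G\<close> by blast
    moreover have "card {u, v} \<le> 2" by (simp add: card_insert_if)
    ultimately show False using card by simp
  qed
  show ?thesis
  proof
    show "finite (pverts G)" by (rule pair_finite_verts)
    show "pverts G \<noteq> {}" using card by auto
    show "\<exists>xs. 2 \<le> length xs \<and> distinct xs \<and> set xs = {u. (v, u) \<in> parcs G} \<and>
      (\<forall>i < length xs. \<forall>j < length xs. (xs ! i, xs ! j) \<in> parcs G \<longleftrightarrow> j = Suc i \<or> i = Suc j)"
      if "v \<in> pverts G" for v
      using link[OF that] two[OF that] by metis
    show "\<exists>u \<in> S. \<exists>w \<in> pverts G - S. (u, w) \<in> parcs G"
      if "S \<subseteq> pverts G" "S \<noteq> {}" "S \<noteq> pverts G" for S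
      using connected_edge_out[OF G(1,2) that] .
  qed (use in_arcsD1 arcs_symmetric no_loops' in blast)+
qed

section \<open>The extremal graph\<close>

text \<open>With \<open>zip\<close> in place of indices, the links of a concrete graph can be
  checked by evaluation.\<close>

lemma path_graphI:
  assumes "xs \<noteq> []" "distinct xs" "verts H = set xs"
    and ends: "arcs_ends H = set (zip xs (tl xs)) \<union> set (zip (tl xs) xs)"
  shows "path_graph H"
proof -
  have "arcs_ends H = {(xs ! i, xs ! j) | i j.
      i < length xs \<and> j < length xs \<and> (j = Suc i \<or> i = Suc j)}" (is "_ = ?R")
  proof (intro set_eqI iffI)
    fix e assume "e \<in> arcs_ends H"
    then have "\<exists>i. Suc i < length xs \<and> (e = (xs ! i, xs ! Suc i) \<or> e = (xs ! Suc i, xs ! i))"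
      unfolding ends by (force simp: set_zip nth_tl less_diff_conv)
    then show "e \<in> ?R" by fastforce
  next
    fix e assume "e \<in> ?R"
    then have "\<exists>i. Suc i < length xs \<and> (e = (xs ! i, xs ! Suc i) \<or> e = (xs ! Suc i, xs ! i))"
      by auto
    then obtain i where i: "Suc i < length xs"
      "e = (xs ! i, xs ! Suc i) \<or> e = (xs ! Suc i, xs ! i)" by blast
    then have "i < length (tl xs)" "i < length xs" "tl xs ! i = xs ! Suc i"
      by (simp_all add: nth_tl less_diff_conv)
    then show "e \<in> arcs_ends H"
      using i(2) unfolding ends set_zip by (metis (mono_tags, lifting) UnI1 UnI2 mem_Collect_eq min_less_iff_conj)
  qed
  then show ?thesis unfolding path_graph_def using assms by blast
qed

text \<open>Vertices 0 to 3 form the inner cycle, 4 to 7 the ring, and 8 to 11 have degree 2.\<close>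

definition sun_edges :: "(nat \<times> nat) list" where
  "sun_edges =
    [(0, 1), (1, 2), (2, 3), (3, 0),
     (4, 5), (5, 6), (6, 7), (7, 4),
     (0, 4), (0, 5), (1, 5), (1, 6), (2, 6), (2, 7), (3, 7), (3, 4),
     (8, 4), (8, 5), (9, 5), (9, 6), (10, 6), (10, 7), (11, 7), (11, 4)]"

definition sun_arcs :: "(nat \<times> nat) list" where
  "sun_arcs = sun_edges @ map prod.swap sun_edges"

definition sun_graph :: "nat pair_pre_digraph" where
  "sun_graph = \<lparr>pverts = {..<12}, parcs = set sun_arcs\<rparr>"

text \<open>Each entry is ordered along the link path, so its first and last vertices are the
  boundary neighbours.\<close>

definition sun_link :: "nat \<Rightarrow> nat list" where
  "sun_link v =
    [[3, 4, 5, 1], [0, 5, 6, 2], [1, 6, 7, 3], [2, 7, 4, 0],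
     [11, 7, 3, 0, 5, 8], [8, 4, 0, 1, 6, 9], [9, 5, 1, 2, 7, 10], [10, 6, 2, 3, 4, 11],
     [4, 5], [5, 6], [6, 7], [7, 4]] ! v"

lemma sun_graph_simps:
  "pverts sun_graph = {..<12}" "parcs sun_graph = set sun_arcs"
  unfolding sun_graph_def by simp_all

lemma sun_arcs_swap: "(u, v) \<in> set sun_arcs \<Longrightarrow> (v, u) \<in> set sun_arcs"
  unfolding sun_arcs_def by auto

lemma sun_pair_graph: "pair_graph sun_graph"
proof
  have "\<forall>e \<in> set sun_arcs. fst e < 12 \<and> snd e < 12 \<and> fst e \<noteq> snd e"
    unfolding sun_arcs_def sun_edges_def by simp
  then show "fst e \<in> pverts sun_graph" "snd e \<in> pverts sun_graph" "fst e \<noteq> snd e"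
    if "e \<in> parcs sun_graph" for e
    using that unfolding sun_graph_simps by auto
  show "symmetric (with_proj sun_graph)"
    unfolding symmetric_def using sun_arcs_swap by (auto simp: sun_graph_simps intro: symI)
qed (auto simp: sun_graph_simps)

lemma sun_links:
  assumes "v < 12"
  shows "sun_link v \<noteq> [] \<and> distinct (sun_link v) \<and>
    set (map snd (filter (\<lambda>e. fst e = v) sun_arcs)) = set (sun_link v) \<and>
    set (filter (\<lambda>e. fst e \<in> set (sun_link v) \<and> snd e \<in> set (sun_link v)) sun_arcs) =
      set (zip (sun_link v) (tl (sun_link v))) \<union> set (zip (tl (sun_link v)) (sun_link v))"
proof -
  have "\<forall>v \<in> set [0..<12]. sun_link v \<noteq> [] \<and> distinct (sun_link v) \<and>
    set (map snd (filter (\<lambda>e. fst e = v) sun_arcs)) = set (sun_link v) \<and>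
    set (filter (\<lambda>e. fst e \<in> set (sun_link v) \<and> snd e \<in> set (sun_link v)) sun_arcs) =
      set (zip (sun_link v) (tl (sun_link v))) \<union> set (zip (tl (sun_link v)) (sun_link v))"
    by code_simp
  then show ?thesis using assms by auto
qed

lemma sun_locally_linear: "locally_linear (with_proj sun_graph)"
  unfolding locally_linear_def
proof
  fix v assume "v \<in> verts (with_proj sun_graph)"
  then have v: "v < 12" by (simp add: sun_graph_simps)
  note l = sun_links[OF v]
  have N: "neighbourhood (with_proj sun_graph) v = set (sun_link v)"
    using l unfolding neighbourhood_with_proj sun_graph_simps by force
  show "path_graph (with_proj sun_graph \<restriction> neighbourhood (with_proj sun_graph) v)"
    unfolding N
  proof (rule path_graphI[of "sun_link v"])
    show "arcs_ends (with_proj sun_graph \<restriction> set (sun_link v)) =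
      set (zip (sun_link v) (tl (sun_link v))) \<union> set (zip (tl (sun_link v)) (sun_link v))"
      using l unfolding arcs_ends_induced sun_graph_simps by (simp only: set_filter)
  qed (use l in auto)
qed

lemma sun_connected: "Digraph_Component.connected (with_proj sun_graph)"
proof -
  interpret pair_graph sun_graph by (rule sun_pair_graph)
  let ?R = "\<lambda>v. 0 \<rightarrow>\<^sup>*\<^bsub>with_proj sun_graph\<^esub> v"
  have step: "?R v" if "?R u" "(u, v) \<in> set sun_arcs" for u v
    using reachable_adj_trans[OF that(1), of v] that(2) by (simp add: sun_graph_simps)
  have 0: "?R 0" by (simp add: sun_graph_simps)
  note arc = sun_arcs_def sun_edges_def
  have 1: "?R 1" "?R 3" "?R 4" "?R 5" using step[OF 0] unfolding arc by simp_all
  have 2: "?R 2" "?R 6" "?R 9" using step[OF 1(1)] step[OF 1(4)] unfolding arc by simp_all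
  have 3: "?R 7" "?R 8" "?R 11" using step[OF 1(3)] unfolding arc by simp_all
  have 4: "?R 10" using step[OF 2(2)] unfolding arc by simp
  have R: "?R v" if "v < 12" for v
  proof -
    have "v \<in> {0, 1, 2, 3, 4, 5, 6, 7, 8, 9, 10, 11}"
      using that unfolding insert_iff empty_iff by presburger
    then show ?thesis using 0 1 2 3 4 by auto
  qed
  have "u \<rightarrow>\<^sup>*\<^bsub>with_proj sun_graph\<^esub> v" if "u < 12" "v < 12" for u v
    using R[OF that(1)] R[OF that(2)] symmetric_reachable[OF sym_arcs] reachable_trans by blast
  then have "u \<rightarrow>\<^sup>*\<^bsub>with_proj (mk_symmetric (with_proj sun_graph))\<^esub> v" if "u < 12" "v < 12" for u v
    using that reachable_mk_symmetricI by blast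
  then show ?thesis
    unfolding Digraph_Component.connected_def strongly_connected_def
    by (auto simp: sun_graph_simps dest: equals0D[of _ 0])
qed

text \<open>Pigeonhole: the arcs leaving \<open>X\<close> have at least \<open>card X\<close>
  distinct heads, all in \<open>Y\<close>, so they use up \<open>Y\<close>.\<close>

lemma saturated_heads:
  fixes P :: "('a \<times> 'b) set"
  assumes "finite P" "inj_on snd P" "X \<subseteq> fst ` P" "\<And>e. \<lbrakk>e \<in> P; fst e \<in> X\<rbrakk> \<Longrightarrow> snd e \<in> Y"
    and Y: "finite Y" "card Y \<le> card X"
    and e: "e \<in> P" "snd e \<in> Y"
  shows "fst e \<in> X"
proof -
  define Q where "Q = {e \<in> P. fst e \<in> X}"
  have Q: "finite Q" "inj_on snd Q" "Q \<subseteq> P"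
    using assms(1,2) unfolding Q_def by (auto intro: inj_on_subset)
  have "X = fst ` Q" using assms(3) unfolding Q_def by auto
  then have "card X \<le> card Q" using Q(1) card_image_le by blast
  also have "card Q = card (snd ` Q)" using Q(2) by (simp add: card_image)
  finally have "card Y \<le> card (snd ` Q)" using Y(2) by simp
  moreover have "snd ` Q \<subseteq> Y" using assms(4) unfolding Q_def by auto
  ultimately have "snd ` Q = Y" using Y(1) by (metis card_seteq)
  then obtain e' where "e' \<in> Q" "snd e' = snd e" using e(2) by (metis imageE)
  then have "e = e'" using assms(2) e(1) Q(3) by (metis inj_onD subsetD)
  then show ?thesis using \<open>e' \<in> Q\<close> unfolding Q_def by simp
qed

lemma pcas_invariant:
  assumes "pcas u p v" "\<And>e. e \<in> set p \<Longrightarrow> fst e \<in> X \<longleftrightarrow> snd e \<in> X" "e \<in> set p"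
  shows "fst e \<in> X \<longleftrightarrow> u \<in> X"
  using assms
proof (induction p arbitrary: u)
  case (Cons f p)
  have "fst f \<in> X \<longleftrightarrow> snd f \<in> X" using Cons.prems(2) by simp
  moreover have "fst e \<in> X \<longleftrightarrow> snd f \<in> X" if "e \<in> set p" using Cons that by simp
  moreover have "fst f = u" "e = f \<or> e \<in> set p" using Cons.prems by simp_all
  ultimately show ?case by blast
qed simp

lemma sun_not_hamiltonian: "\<not> hamiltonian (with_proj sun_graph)"
proof
  assume "hamiltonian (with_proj sun_graph)"
  interpret pair_graph sun_graph by (rule sun_pair_graph)
  obtain p u where p: "awalk u p u" "distinct (tl (pawalk_verts u p))" "p \<noteq> []"
    and cover: "fst ` set p = {..<12}"
    using \<open>hamiltonian _\<close> unfolding hamiltonian_def cycle_def by (auto simp: sun_graph_simps)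
  have arcs: "set p \<subseteq> set sun_arcs" and cas: "pcas u p u"
    using p(1) unfolding awalk_def by (auto simp: sun_graph_simps)
  have "tl (pawalk_verts u p) = map snd p" using awalk_verts_conv'[of u p u] cas p(3) by simp
  then have inj: "inj_on snd (set p)" using p(2) by (simp add: distinct_map)
  have tips: "\<forall>e \<in> set sun_arcs. fst e \<in> {8, 9, 10, 11} \<longrightarrow> snd e \<in> {4, 5, 6, 7}"
    and inner: "\<forall>e \<in> set sun_arcs. fst e \<in> {0, 1, 2, 3} \<longrightarrow> snd e \<in> {0, 1, 2, 3} \<or> snd e \<in> {4, 5, 6, 7}"
    unfolding sun_arcs_def sun_edges_def by simp_all
  \<comment> \<open>The four vertices of degree 2 have four distinct successors, all in the ring, so
    every ring vertex is entered from one of them.\<close>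
  have into_ring: "fst e \<in> {8, 9, 10, 11}" if "e \<in> set p" "snd e \<in> {4, 5, 6, 7}" for e
    by (rule saturated_heads[OF _ inj _ _ _ _ that]) (use cover tips arcs in auto)
  have stay: "snd e \<in> {0, 1, 2, 3}" if "e \<in> set p" "fst e \<in> {0, 1, 2, 3}" for e
    using into_ring[OF that(1)] inner arcs that by fastforce
  \<comment> \<open>The same count for the inner cycle, whose arcs now stay inside: nothing enters
    it either, so the closed walk never crosses its border.\<close>
  have "fst e \<in> {0, 1, 2, 3}" if "e \<in> set p" "snd e \<in> {0, 1, 2, 3}" for e
    by (rule saturated_heads[OF _ inj _ _ _ _ that]) (use cover stay in auto)
  then have const: "fst e \<in> {0, 1, 2, 3} \<longleftrightarrow> u \<in> {0, 1, 2, 3}" if "e \<in> set p" for e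
    using pcas_invariant[OF cas _ that, of "{0, 1, 2, 3}"] stay by blast
  have "0 \<in> fst ` set p" "4 \<in> fst ` set p" using cover by auto
  then obtain e f where "e \<in> set p" "fst e = 0" "f \<in> set p" "fst f = 4" by (metis imageE)
  then show False using const[of e] const[of f] by simp
qed

theorem theorem1:
  shows "(\<forall>G :: 'a pair_pre_digraph.
            pair_graph G \<and> Digraph_Component.connected (with_proj G) \<and>
            locally_linear (with_proj G) \<and> \<not> hamiltonian (with_proj G) \<and>
            3 \<le> card (pverts G) \<longrightarrow> 12 \<le> card (pverts G)) \<and>
         (\<exists>G :: nat pair_pre_digraph.
            pair_graph G \<and> Digraph_Component.connected (with_proj G) \<and>
            locally_linear (with_proj G) \<and> \<not> hamiltonian (with_proj G) \<and>
            card (pverts G) = 12)"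
proof (intro conjI allI impI)
  fix G :: "'a pair_pre_digraph"
  assume G: "pair_graph G \<and> Digraph_Component.connected (with_proj G) \<and>
    locally_linear (with_proj G) \<and> \<not> hamiltonian (with_proj G) \<and> 3 \<le> card (pverts G)"
  then interpret locally_linear_graph "pverts G" "\<lambda>u v. (u, v) \<in> parcs G"
    using locally_linear_graph_of_digraph by blast
  show "12 \<le> card (pverts G)"
    using nonhamiltonian_bound hamiltonianI[of G] G by blast
next
  have "card (pverts sun_graph) = 12" by (simp add: sun_graph_simps)
  then show "\<exists>G :: nat pair_pre_digraph.
            pair_graph G \<and> Digraph_Component.connected (with_proj G) \<and>
            locally_linear (with_proj G) \<and> \<not> hamiltonian (with_proj G) \<and>
            card (pverts G) = 12"
    using sun_pair_graph sun_connected sun_locally_linear sun_not_hamiltonian by blast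
qed

end
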